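(* Let $\Sigma$ be a similarity type of algebras. Then there exists a diagram, indexed by a distributive lattice, of finite products of finite simple lattices and $\langle\vee,0\rangle$-embeddings, without a lifting, with respect to the $\mathrm{Con_c}$ functor, by algebras with similarity type $\Sigma$.
   Context: Algebras with similarity type $\Sigma$ form a category with all homomorphisms. For such an algebra $A$, $\mathrm{Con_c}\,A$ is the $\langle\vee,0\rangle$-semilattice of compact (i.e., finitely generated) congruences of $A$ under join. For a homomorphism $f\colon A\to B$, $\mathrm{Con_c}\,f\colon\mathrm{Con_c}\,A\to\mathrm{Con_c}\,B$ sends a compact congruence $\boldsymbol{a}$ to the congruence of $B$ generated by $\{\langle f(x),f(y)\rangle\mid\langle x,y\rangle\in\boldsymbol{a}\}$. This defines a functor $\mathrm{Con_c}$ to the category $\mathcal{S}$ of all $\langle\vee,0\rangle$-semilattices (join-semilattices with least element $0$) and $\langle\vee,0\rangle$-homomorphisms. A $\langle\vee,0\rangle$-embedding is a one-to-one map preserving $\vee$ and $0$ (a greatest element need not be preserved). Finite lattices are viewed as $\langle\vee,0\rangle$-semilattices; a lattice is simple if its only congruences are equality and the full relation. A diagram indexed by a lattice $\mathcal{I}$ is a functor from $\mathcal{I}$, viewed as a category via its order, to $\mathcal{S}$; here its objects are finite products of finite simple lattices and its arrows are $\langle\vee,0\rangle$-embeddings. A lifting of $\mathbf{D}\colon\mathcal{I}\to\mathcal{S}$ with respect to $\mathrm{Con_c}$ by algebras with similarity type $\Sigma$ is a functor $\mathbf{E}$ from $\mathcal{I}$ to the category of algebras with similarity type $\Sigma$ and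 homomorphisms such that $\mathrm{Con_c}\,\mathbf{E}$ is naturally isomorphic to $\mathbf{D}$. *)

theory Defs
  imports "HOL-Algebra.Lattice"
begin

section \<open>Algebras and compact congruences\<close>

record 'f similarity_type =
  symbols :: "'f set"
  arity :: "'f \<Rightarrow> nat"

record ('f, 'a) ualgebra = "'a partial_object" +
  ops :: "'f \<Rightarrow> 'a list \<Rightarrow> 'a"

text \<open>The empty algebra is admitted (when there are no constants), so that the absence of a
  lifting covers both conventions about empty algebras.\<close>

definition is_ualgebra :: "'f similarity_type \<Rightarrow> ('f, 'a) ualgebra \<Rightarrow> bool" where
  "is_ualgebra \<Sigma> A \<longleftrightarrow>
    (\<forall>f \<in> symbols \<Sigma>. \<forall>xs. length xs = arity \<Sigma> f \<and> set xs \<subseteq> carrier A \<longrightarrow> ops A f xs \<in> carrier A)"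

definition ualg_hom ::
  "'f similarity_type \<Rightarrow> ('f, 'a) ualgebra \<Rightarrow> ('f, 'b) ualgebra \<Rightarrow> ('a \<Rightarrow> 'b) set" where
  "ualg_hom \<Sigma> A B = {h. h \<in> carrier A \<rightarrow> carrier B \<and>
    (\<forall>f \<in> symbols \<Sigma>. \<forall>xs. length xs = arity \<Sigma> f \<and> set xs \<subseteq> carrier A \<longrightarrow>
       h (ops A f xs) = ops B f (map h xs))}"

definition congruence :: "'f similarity_type \<Rightarrow> ('f, 'a) ualgebra \<Rightarrow> ('a \<times> 'a) set \<Rightarrow> bool" where
  "congruence \<Sigma> A \<theta> \<longleftrightarrow> equiv (carrier A) \<theta> \<and>
    (\<forall>f \<in> symbols \<Sigma>. \<forall>xs ys. length xs = arity \<Sigma> f \<and> length ys = arity \<Sigma> f \<and>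
       list_all2 (\<lambda>x y. (x, y) \<in> \<theta>) xs ys \<longrightarrow> (ops A f xs, ops A f ys) \<in> \<theta>)"

definition cgen :: "'f similarity_type \<Rightarrow> ('f, 'a) ualgebra \<Rightarrow> ('a \<times> 'a) set \<Rightarrow> ('a \<times> 'a) set" where
  "cgen \<Sigma> A X = \<Inter>{\<theta>. congruence \<Sigma> A \<theta> \<and> X \<subseteq> \<theta>}"

definition Con_c :: "'f similarity_type \<Rightarrow> ('f, 'a) ualgebra \<Rightarrow> ('a \<times> 'a) set gorder" where
  "Con_c \<Sigma> A = \<lparr> carrier = {cgen \<Sigma> A X | X. finite X \<and> X \<subseteq> carrier A \<times> carrier A},
                 eq = (=), le = (\<subseteq>) \<rparr>"

text \<open>Action of the functor on a homomorphism \<open>h\<close> with codomain \<open>B\<close>.\<close>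

definition Con_c_map ::
  "'f similarity_type \<Rightarrow> ('f, 'b) ualgebra \<Rightarrow> ('a \<Rightarrow> 'b) \<Rightarrow> ('a \<times> 'a) set \<Rightarrow> ('b \<times> 'b) set" where
  "Con_c_map \<Sigma> B h \<theta> = cgen \<Sigma> B (map_prod h h ` \<theta>)"


section \<open>Semilattices and lattices\<close>

locale join_zero_semilattice = upper_semilattice + weak_partial_order_bottom

definition slat_hom :: "'a gorder \<Rightarrow> 'b gorder \<Rightarrow> ('a \<Rightarrow> 'b) set" where
  "slat_hom L M = {h. h \<in> carrier L \<rightarrow> carrier M \<and>
    (\<forall>x \<in> carrier L. \<forall>y \<in> carrier L. h (x \<squnion>\<^bsub>L\<^esub> y) = h x \<squnion>\<^bsub>M\<^esub> h y) \<and> h \<bottom>\<^bsub>L\<^esub> = \<bottom>\<^bsub>M\<^esub>}"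

definition slat_iso :: "'a gorder \<Rightarrow> 'b gorder \<Rightarrow> ('a \<Rightarrow> 'b) set" where
  "slat_iso L M = {h \<in> slat_hom L M. bij_betw h (carrier L) (carrier M)}"

locale distributive_lattice = lattice +
  assumes meet_join_distrib:
    "\<lbrakk>x \<in> carrier L; y \<in> carrier L; z \<in> carrier L\<rbrakk> \<Longrightarrow> x \<sqinter> (y \<squnion> z) = (x \<sqinter> y) \<squnion> (x \<sqinter> z)"

definition lattice_congruence :: "'a gorder \<Rightarrow> ('a \<times> 'a) set \<Rightarrow> bool" where
  "lattice_congruence L \<theta> \<longleftrightarrow> equiv (carrier L) \<theta> \<and>
    (\<forall>x x' y y'. (x, x') \<in> \<theta> \<and> (y, y') \<in> \<theta> \<longrightarrow>
       (x \<squnion>\<^bsub>L\<^esub> y, x' \<squnion>\<^bsub>L\<^esub> y') \<in> \<theta> \<and> (x \<sqinter>\<^bsub>L\<^esub> y, x' \<sqinter>\<^bsub>L\<^esub> y') \<in> \<theta>)"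

definition finite_simple_lattice :: "'a gorder \<Rightarrow> bool" where
  "finite_simple_lattice L \<longleftrightarrow> lattice L \<and> finite (carrier L) \<and> carrier L \<noteq> {} \<and>
    (\<forall>\<theta>. lattice_congruence L \<theta> \<longrightarrow> \<theta> = Id_on (carrier L) \<or> \<theta> = carrier L \<times> carrier L)"

definition product_order :: "nat \<Rightarrow> (nat \<Rightarrow> 'a gorder) \<Rightarrow> (nat \<Rightarrow> 'a) gorder" where
  "product_order n L = \<lparr> carrier = (\<Pi>\<^sub>E k\<in>{..<n}. carrier (L k)),
                         eq = (=), le = (\<lambda>x y. \<forall>k<n. x k \<sqsubseteq>\<^bsub>L k\<^esub> y k) \<rparr>"


section \<open>Diagrams and liftings\<close>

text \<open>Functors from a partially ordered set \<open>I\<close> to a concrete category with the given objects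
  and hom-sets; \<open>e i j\<close> is the arrow belonging to \<open>i \<sqsubseteq> j\<close>.  Arrows are total HOL
  functions that matter only on carriers.\<close>

definition poset_functor ::
  "'i gorder \<Rightarrow> (('a, 'm) partial_object_scheme \<Rightarrow> bool) \<Rightarrow>
   (('a, 'm) partial_object_scheme \<Rightarrow> ('a, 'm) partial_object_scheme \<Rightarrow> ('a \<Rightarrow> 'a) set) \<Rightarrow>
   ('i \<Rightarrow> ('a, 'm) partial_object_scheme) \<Rightarrow> ('i \<Rightarrow> 'i \<Rightarrow> 'a \<Rightarrow> 'a) \<Rightarrow> bool" where
  "poset_functor I Obj Hom E e \<longleftrightarrow>
    (\<forall>i \<in> carrier I. Obj (E i)) \<and>
    (\<forall>i \<in> carrier I. \<forall>j \<in> carrier I. i \<sqsubseteq>\<^bsub>I\<^esub> j \<longrightarrow> e i j \<in> Hom (E i) (E j)) \<and>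
    (\<forall>i \<in> carrier I. \<forall>x \<in> carrier (E i). e i i x = x) \<and>
    (\<forall>i \<in> carrier I. \<forall>j \<in> carrier I. \<forall>k \<in> carrier I. i \<sqsubseteq>\<^bsub>I\<^esub> j \<and> j \<sqsubseteq>\<^bsub>I\<^esub> k \<longrightarrow>
       (\<forall>x \<in> carrier (E i). e j k (e i j x) = e i k x))"

abbreviation slat_diagram :: "'i gorder \<Rightarrow> ('i \<Rightarrow> 's gorder) \<Rightarrow> ('i \<Rightarrow> 'i \<Rightarrow> 's \<Rightarrow> 's) \<Rightarrow> bool" where
  "slat_diagram I D d \<equiv> poset_functor I join_zero_semilattice slat_hom D d"

abbreviation ualg_diagram ::
  "'f similarity_type \<Rightarrow> 'i gorder \<Rightarrow> ('i \<Rightarrow> ('f, 'a) ualgebra) \<Rightarrow> ('i \<Rightarrow> 'i \<Rightarrow> 'a \<Rightarrow> 'a) \<Rightarrow> bool" where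
  "ualg_diagram \<Sigma> I E e \<equiv> poset_functor I (is_ualgebra \<Sigma>) (ualg_hom \<Sigma>) E e"

definition is_lifting ::
  "'f similarity_type \<Rightarrow> 'i gorder \<Rightarrow> ('i \<Rightarrow> 's gorder) \<Rightarrow> ('i \<Rightarrow> 'i \<Rightarrow> 's \<Rightarrow> 's) \<Rightarrow>
   ('i \<Rightarrow> ('f, 'a) ualgebra) \<Rightarrow> ('i \<Rightarrow> 'i \<Rightarrow> 'a \<Rightarrow> 'a) \<Rightarrow> bool" where
  "is_lifting \<Sigma> I D d E e \<longleftrightarrow> ualg_diagram \<Sigma> I E e \<and>
    (\<exists>\<eta>. (\<forall>i \<in> carrier I. \<eta> i \<in> slat_iso (Con_c \<Sigma> (E i)) (D i)) \<and>
         (\<forall>i \<in> carrier I. \<forall>j \<in> carrier I. i \<sqsubseteq>\<^bsub>I\<^esub> j \<longrightarrow>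
            (\<forall>\<alpha> \<in> carrier (Con_c \<Sigma> (E i)).
               \<eta> j (Con_c_map \<Sigma> (E j) (e i j) \<alpha>) = d i j (\<eta> i \<alpha>))))"

text \<open>HOL cannot quantify over the type of the elements of the algebras inside a formula.  The
  following type, which depends only on the types of the operation symbols, of the index poset
  and of the semilattices, is large enough to make this harmless: by a Loewenheim--Skolem
  argument, theorem \<open>is_lifting_imp_has_lifting\<close> below, a lifting by algebras over any type whatsoever
  yields a lifting over this one.\<close>

datatype ('i, 's, 'f) elem_name =
    Gen 'i 's nat
  | App 'i 'f "('i, 's, 'f) elem_name list"
  | Arr 'i 'i "('i, 's, 'f) elem_name"
  | Wit 'i nat "('i, 's, 'f) elem_name list"

definition has_lifting ::
  "'f similarity_type \<Rightarrow> 'i gorder \<Rightarrow> ('i \<Rightarrow> 's gorder) \<Rightarrow> ('i \<Rightarrow> 'i \<Rightarrow> 's \<Rightarrow> 's) \<Rightarrow> bool" where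
  "has_lifting \<Sigma> I D d \<longleftrightarrow>
    (\<exists>(E :: 'i \<Rightarrow> ('f, ('i, 's, 'f) elem_name) ualgebra) e. is_lifting \<Sigma> I D d E e)"


section \<open>Independence of \<open>has_lifting\<close> from the chosen type\<close>

lemma congruence_full:
  assumes A: "is_ualgebra \<Sigma> A" shows "congruence \<Sigma> A (carrier A \<times> carrier A)"
proof -
  have "ops A f xs \<in> carrier A" "ops A f ys \<in> carrier A"
    if "f \<in> symbols \<Sigma>" "length xs = arity \<Sigma> f" "length ys = arity \<Sigma> f"
      "list_all2 (\<lambda>x y. (x, y) \<in> carrier A \<times> carrier A) xs ys" for f xs ys
  proof -
    have "set xs \<subseteq> carrier A" "set ys \<subseteq> carrier A"
      using that(4) by (auto simp: list_all2_conv_all_nth in_set_conv_nth)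
    then show "ops A f xs \<in> carrier A" "ops A f ys \<in> carrier A"
      using A that by (auto simp: is_ualgebra_def)
  qed
  then show ?thesis
    by (auto simp: congruence_def equiv_def refl_on_def sym_def trans_def)
qed

lemma cgen_superset: "X \<subseteq> cgen \<Sigma> A X"
  by (auto simp: cgen_def)

lemma cgen_least: "congruence \<Sigma> A \<theta> \<Longrightarrow> X \<subseteq> \<theta> \<Longrightarrow> cgen \<Sigma> A X \<subseteq> \<theta>"
  by (auto simp: cgen_def)

lemma cgen_subset:
  "is_ualgebra \<Sigma> A \<Longrightarrow> X \<subseteq> carrier A \<times> carrier A \<Longrightarrow> cgen \<Sigma> A X \<subseteq> carrier A \<times> carrier A"
  using cgen_least congruence_full by blast

lemma cgen_congruence:
  assumes A: "is_ualgebra \<Sigma> A" and X: "X \<subseteq> carrier A \<times> carrier A"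
  shows "congruence \<Sigma> A (cgen \<Sigma> A X)"
proof -
  define S where "S = {\<theta>. congruence \<Sigma> A \<theta> \<and> X \<subseteq> \<theta>}"
  have full: "carrier A \<times> carrier A \<in> S"
    using congruence_full[OF A] X by (auto simp: S_def)
  have eq: "equiv (carrier A) \<theta>" if "\<theta> \<in> S" for \<theta>
    using that by (auto simp: S_def congruence_def)
  have "equiv (carrier A) (\<Inter>S)"
  proof (rule equivI)
    show "\<Inter>S \<subseteq> carrier A \<times> carrier A" using full by blast
    show "refl_on (carrier A) (\<Inter>S)"
      using eq by (auto simp: refl_on_def equiv_def)
    show "sym (\<Inter>S)"
      using eq by (auto simp: sym_def equiv_def)
    show "trans (\<Inter>S)"
      unfolding trans_def using eq by (meson InterE InterI equiv_def transE)
  qed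
  moreover have "(ops A f xs, ops A f ys) \<in> \<Inter>S"
    if "f \<in> symbols \<Sigma>" "length xs = arity \<Sigma> f" "length ys = arity \<Sigma> f"
      "list_all2 (\<lambda>x y. (x, y) \<in> \<Inter>S) xs ys" for f xs ys
  proof
    fix \<theta> assume \<theta>: "\<theta> \<in> S"
    have "list_all2 (\<lambda>x y. (x, y) \<in> \<theta>) xs ys"
      using that(4) \<theta> by (auto simp: list_all2_conv_all_nth)
    then show "(ops A f xs, ops A f ys) \<in> \<theta>"
      using \<theta> that by (auto simp: S_def congruence_def)
  qed
  ultimately show ?thesis
    by (auto simp: congruence_def cgen_def S_def)
qed

lemma congruence_pullback:
  assumes A: "is_ualgebra \<Sigma> A" and h: "h \<in> ualg_hom \<Sigma> A B" and \<theta>: "congruence \<Sigma> B \<theta>"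
  shows "congruence \<Sigma> A {(x, y). x \<in> carrier A \<and> y \<in> carrier A \<and> (h x, h y) \<in> \<theta>}"
    (is "congruence \<Sigma> A ?R")
proof -
  have eq: "equiv (carrier B) \<theta>" using \<theta> by (auto simp: congruence_def)
  have hc: "h x \<in> carrier B" if "x \<in> carrier A" for x
    using h that by (auto simp: ualg_hom_def)
  have "equiv (carrier A) ?R"
  proof (rule equivI)
    show "?R \<subseteq> carrier A \<times> carrier A" by auto
    show "refl_on (carrier A) ?R" using eq hc by (auto simp: refl_on_def equiv_def)
    show "sym ?R" using eq by (auto simp: sym_def equiv_def)
    show "trans ?R" using eq by (auto simp: equiv_def trans_def)
  qed
  moreover have "(ops A f xs, ops A f ys) \<in> ?R"
    if f: "f \<in> symbols \<Sigma>" "length xs = arity \<Sigma> f" "length ys = arity \<Sigma> f"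
      and l: "list_all2 (\<lambda>x y. (x, y) \<in> ?R) xs ys" for f xs ys
  proof -
    have s: "set xs \<subseteq> carrier A" "set ys \<subseteq> carrier A"
      using l by (auto simp: list_all2_conv_all_nth in_set_conv_nth)
    have "list_all2 (\<lambda>x y. (x, y) \<in> \<theta>) (map h xs) (map h ys)"
      using l by (auto simp: list_all2_conv_all_nth)
    then have "(ops B f (map h xs), ops B f (map h ys)) \<in> \<theta>"
      using \<theta> f by (auto simp: congruence_def)
    then show ?thesis
      using A h f s by (auto simp: ualg_hom_def is_ualgebra_def)
  qed
  ultimately show ?thesis by (auto simp: congruence_def)
qed

lemma ualg_hom_pairs:
  "h \<in> ualg_hom \<Sigma> A B \<Longrightarrow> X \<subseteq> carrier A \<times> carrier A \<Longrightarrow> map_prod h h ` X \<subseteq> carrier B \<times> carrier B"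
  by (auto simp: ualg_hom_def)

lemma cgen_hom:
  assumes A: "is_ualgebra \<Sigma> A" and B: "is_ualgebra \<Sigma> B" and h: "h \<in> ualg_hom \<Sigma> A B"
    and X: "X \<subseteq> carrier A \<times> carrier A"
  shows "map_prod h h ` cgen \<Sigma> A X \<subseteq> cgen \<Sigma> B (map_prod h h ` X)"
proof -
  have c: "congruence \<Sigma> B (cgen \<Sigma> B (map_prod h h ` X))"
    using cgen_congruence[OF B ualg_hom_pairs[OF h X]] .
  have "cgen \<Sigma> A X \<subseteq>
      {(x, y). x \<in> carrier A \<and> y \<in> carrier A \<and> (h x, h y) \<in> cgen \<Sigma> B (map_prod h h ` X)}"
    using X cgen_superset[of "map_prod h h ` X" \<Sigma> B]
    by (intro cgen_least congruence_pullback[OF A h c]) force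
  then show ?thesis by force
qed

lemma Con_c_map_cgen:
  assumes A: "is_ualgebra \<Sigma> A" and B: "is_ualgebra \<Sigma> B" and h: "h \<in> ualg_hom \<Sigma> A B"
    and X: "X \<subseteq> carrier A \<times> carrier A"
  shows "Con_c_map \<Sigma> B h (cgen \<Sigma> A X) = cgen \<Sigma> B (map_prod h h ` X)"
  unfolding Con_c_map_def
proof
  have c: "congruence \<Sigma> B (cgen \<Sigma> B (map_prod h h ` X))"
    using cgen_congruence[OF B ualg_hom_pairs[OF h X]] .
  show "cgen \<Sigma> B (map_prod h h ` cgen \<Sigma> A X) \<subseteq> cgen \<Sigma> B (map_prod h h ` X)"
    by (intro cgen_least c cgen_hom[OF A B h X])
  have Y: "map_prod h h ` cgen \<Sigma> A X \<subseteq> carrier B \<times> carrier B"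
    by (intro ualg_hom_pairs[OF h] cgen_subset A X)
  show "cgen \<Sigma> B (map_prod h h ` X) \<subseteq> cgen \<Sigma> B (map_prod h h ` cgen \<Sigma> A X)"
    using cgen_superset[of X \<Sigma> A] cgen_superset[of "map_prod h h ` cgen \<Sigma> A X" \<Sigma> B]
    by (intro cgen_least cgen_congruence[OF B Y]) blast
qed

lemma cgen_Un_cgen:
  assumes A: "is_ualgebra \<Sigma> A" and X: "X \<subseteq> carrier A \<times> carrier A" and Y: "Y \<subseteq> carrier A \<times> carrier A"
  shows "cgen \<Sigma> A (cgen \<Sigma> A X \<union> cgen \<Sigma> A Y) = cgen \<Sigma> A (X \<union> Y)"
proof
  have XY: "X \<union> Y \<subseteq> carrier A \<times> carrier A" using X Y by blast
  have c: "cgen \<Sigma> A X \<union> cgen \<Sigma> A Y \<subseteq> carrier A \<times> carrier A"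
    using cgen_subset[OF A X] cgen_subset[OF A Y] by blast
  have "X \<union> Y \<subseteq> cgen \<Sigma> A (X \<union> Y)" by (rule cgen_superset)
  then show "cgen \<Sigma> A (cgen \<Sigma> A X \<union> cgen \<Sigma> A Y) \<subseteq> cgen \<Sigma> A (X \<union> Y)"
    by (intro cgen_least Un_least cgen_congruence A XY) auto
  show "cgen \<Sigma> A (X \<union> Y) \<subseteq> cgen \<Sigma> A (cgen \<Sigma> A X \<union> cgen \<Sigma> A Y)"
    using cgen_superset[of X \<Sigma> A] cgen_superset[of Y \<Sigma> A]
      cgen_superset[of "cgen \<Sigma> A X \<union> cgen \<Sigma> A Y" \<Sigma> A]
    by (intro cgen_least cgen_congruence[OF A c]) blast
qed

lemma map_prod_image_cancel:
  assumes "\<And>x. x \<in> S \<Longrightarrow> g (h x) = x" "Y \<subseteq> S \<times> S"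
  shows "map_prod g g ` map_prod h h ` Y = Y"
proof -
  have "map_prod g g (map_prod h h p) = p" if "p \<in> Y" for p
    using subsetD[OF assms(2) that] assms(1) by (cases p) simp
  then show ?thesis by (simp add: image_image)
qed

lemma carrier_Con_cE:
  assumes "\<alpha> \<in> carrier (Con_c \<Sigma> A)"
  obtains X where "finite X" "X \<subseteq> carrier A \<times> carrier A" "\<alpha> = cgen \<Sigma> A X"
  using assms by (auto simp: Con_c_def)

lemma cgen_in_Con_c:
  "finite X \<Longrightarrow> X \<subseteq> carrier A \<times> carrier A \<Longrightarrow> cgen \<Sigma> A X \<in> carrier (Con_c \<Sigma> A)"
  by (auto simp: Con_c_def)

lemma partial_order_Con_c: "partial_order (Con_c \<Sigma> A)"
  by unfold_locales (auto simp: Con_c_def)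

lemma Con_c_lub:
  assumes A: "is_ualgebra \<Sigma> A" and \<alpha>: "\<alpha> \<in> carrier (Con_c \<Sigma> A)" and \<beta>: "\<beta> \<in> carrier (Con_c \<Sigma> A)"
  shows "least (Con_c \<Sigma> A) (cgen \<Sigma> A (\<alpha> \<union> \<beta>)) (Upper (Con_c \<Sigma> A) {\<alpha>, \<beta>})"
proof -
  obtain X where X: "finite X" "X \<subseteq> carrier A \<times> carrier A" "\<alpha> = cgen \<Sigma> A X"
    using \<alpha> by (rule carrier_Con_cE)
  obtain Y where Y: "finite Y" "Y \<subseteq> carrier A \<times> carrier A" "\<beta> = cgen \<Sigma> A Y"
    using \<beta> by (rule carrier_Con_cE)
  have in_c: "cgen \<Sigma> A (\<alpha> \<union> \<beta>) \<in> carrier (Con_c \<Sigma> A)"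
    unfolding X(3) Y(3) cgen_Un_cgen[OF A X(2) Y(2)]
    by (intro cgen_in_Con_c) (use X Y in auto)
  have cong: "congruence \<Sigma> A \<gamma>" if "\<gamma> \<in> carrier (Con_c \<Sigma> A)" for \<gamma>
    using that by (metis carrier_Con_cE cgen_congruence A)
  have le: "(\<sqsubseteq>\<^bsub>Con_c \<Sigma> A\<^esub>) = (\<subseteq>)" by (simp add: Con_c_def)
  have up: "\<alpha> \<union> \<beta> \<subseteq> cgen \<Sigma> A (\<alpha> \<union> \<beta>)" by (rule cgen_superset)
  have low: "cgen \<Sigma> A (\<alpha> \<union> \<beta>) \<subseteq> \<gamma>"
    if "\<gamma> \<in> carrier (Con_c \<Sigma> A)" "\<alpha> \<subseteq> \<gamma>" "\<beta> \<subseteq> \<gamma>" for \<gamma>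
    using that by (intro cgen_least cong) auto
  show ?thesis
    unfolding least_def Upper_def le
  proof (intro conjI ballI)
    fix \<gamma> assume "\<gamma> \<in> {u. \<forall>x. x \<in> {\<alpha>, \<beta>} \<inter> carrier (Con_c \<Sigma> A) \<longrightarrow> x \<subseteq> u} \<inter> carrier (Con_c \<Sigma> A)"
    then show "cgen \<Sigma> A (\<alpha> \<union> \<beta>) \<subseteq> \<gamma>" using \<alpha> \<beta> by (intro low) simp_all
  qed (use in_c up in auto)
qed

lemma Con_c_bot:
  "is_ualgebra \<Sigma> A \<Longrightarrow> least (Con_c \<Sigma> A) (cgen \<Sigma> A {}) (carrier (Con_c \<Sigma> A))"
  unfolding least_def
  by (auto simp: cgen_in_Con_c elim!: carrier_Con_cE)
     (auto simp: Con_c_def intro: subsetD[OF cgen_least[OF cgen_congruence]])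

lemma join_zero_semilattice_Con_c:
  assumes "is_ualgebra \<Sigma> A" shows "join_zero_semilattice (Con_c \<Sigma> A)"
proof -
  interpret partial_order "Con_c \<Sigma> A" by (rule partial_order_Con_c)
  show ?thesis
  proof unfold_locales
    show "\<exists>s. least (Con_c \<Sigma> A) s (Upper (Con_c \<Sigma> A) {\<alpha>, \<beta>})"
      if "\<alpha> \<in> carrier (Con_c \<Sigma> A)" "\<beta> \<in> carrier (Con_c \<Sigma> A)" for \<alpha> \<beta>
      using Con_c_lub[OF assms that] by (rule exI)
    show "\<exists>x. least (Con_c \<Sigma> A) x (carrier (Con_c \<Sigma> A))"
      using Con_c_bot[OF assms] by (rule exI)
  qed
qed

lemma join_Con_c:
  assumes "is_ualgebra \<Sigma> A" "\<alpha> \<in> carrier (Con_c \<Sigma> A)" "\<beta> \<in> carrier (Con_c \<Sigma> A)"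
  shows "\<alpha> \<squnion>\<^bsub>Con_c \<Sigma> A\<^esub> \<beta> = cgen \<Sigma> A (\<alpha> \<union> \<beta>)"
proof -
  interpret partial_order "Con_c \<Sigma> A" by (rule partial_order_Con_c)
  show ?thesis
    unfolding join_def sup_def
    using Con_c_lub[OF assms] least_unique[OF _ Con_c_lub[OF assms]]
    by (rule some_equality)
qed

lemma bottom_Con_c:
  assumes "is_ualgebra \<Sigma> A" shows "\<bottom>\<^bsub>Con_c \<Sigma> A\<^esub> = cgen \<Sigma> A {}"
proof -
  interpret partial_order "Con_c \<Sigma> A" by (rule partial_order_Con_c)
  show ?thesis
    unfolding bottom_def
    using Con_c_bot[OF assms] least_unique[OF _ Con_c_bot[OF assms]]
    by (rule some_equality)
qed

lemma Con_c_map_slat_hom: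
  assumes A: "is_ualgebra \<Sigma> A" and B: "is_ualgebra \<Sigma> B" and h: "h \<in> ualg_hom \<Sigma> A B"
  shows "Con_c_map \<Sigma> B h \<in> slat_hom (Con_c \<Sigma> A) (Con_c \<Sigma> B)"
proof -
  have cl: "Con_c_map \<Sigma> B h \<alpha> \<in> carrier (Con_c \<Sigma> B)" if "\<alpha> \<in> carrier (Con_c \<Sigma> A)" for \<alpha>
    using that
    by (elim carrier_Con_cE) (simp add: Con_c_map_cgen[OF A B h] cgen_in_Con_c ualg_hom_pairs[OF h])
  have "Con_c_map \<Sigma> B h (\<alpha> \<squnion>\<^bsub>Con_c \<Sigma> A\<^esub> \<beta>) = Con_c_map \<Sigma> B h \<alpha> \<squnion>\<^bsub>Con_c \<Sigma> B\<^esub> Con_c_map \<Sigma> B h \<beta>"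
    if \<alpha>: "\<alpha> \<in> carrier (Con_c \<Sigma> A)" and \<beta>: "\<beta> \<in> carrier (Con_c \<Sigma> A)" for \<alpha> \<beta>
  proof -
    obtain X where X: "X \<subseteq> carrier A \<times> carrier A" "\<alpha> = cgen \<Sigma> A X"
      using \<alpha> by (rule carrier_Con_cE)
    obtain Y where Y: "Y \<subseteq> carrier A \<times> carrier A" "\<beta> = cgen \<Sigma> A Y"
      using \<beta> by (rule carrier_Con_cE)
    have XY: "X \<union> Y \<subseteq> carrier A \<times> carrier A" using X Y by blast
    show ?thesis
      unfolding join_Con_c[OF A \<alpha> \<beta>] join_Con_c[OF B cl[OF \<alpha>] cl[OF \<beta>]]
      unfolding X(2) Y(2) cgen_Un_cgen[OF A X(1) Y(1)] Con_c_map_cgen[OF A B h XY]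
        Con_c_map_cgen[OF A B h X(1)] Con_c_map_cgen[OF A B h Y(1)] image_Un
        cgen_Un_cgen[OF B ualg_hom_pairs[OF h X(1)] ualg_hom_pairs[OF h Y(1)]] ..
  qed
  moreover have "Con_c_map \<Sigma> B h \<bottom>\<^bsub>Con_c \<Sigma> A\<^esub> = \<bottom>\<^bsub>Con_c \<Sigma> B\<^esub>"
    unfolding bottom_Con_c[OF A] bottom_Con_c[OF B] by (simp add: Con_c_map_cgen[OF A B h])
  ultimately show ?thesis using cl by (auto simp: slat_hom_def)
qed

definition subuniverse :: "'f similarity_type \<Rightarrow> ('f, 'a) ualgebra \<Rightarrow> 'a set \<Rightarrow> bool" where
  "subuniverse \<Sigma> A C \<longleftrightarrow> C \<subseteq> carrier A \<and> is_ualgebra \<Sigma> (A\<lparr>carrier := C\<rparr>)"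

text \<open>Membership in a generated congruence is witnessed by finitely many elements.\<close>

definition witnesses ::
  "'f similarity_type \<Rightarrow> ('f, 'a) ualgebra \<Rightarrow> ('a \<times> 'a) set \<Rightarrow> 'a \<Rightarrow> 'a \<Rightarrow> 'a set \<Rightarrow> bool" where
  "witnesses \<Sigma> A X x y Y \<longleftrightarrow> finite Y \<and> Y \<subseteq> carrier A \<and>
    (\<forall>C. subuniverse \<Sigma> A C \<and> X \<subseteq> C \<times> C \<and> Y \<subseteq> C \<longrightarrow> (x, y) \<in> cgen \<Sigma> (A\<lparr>carrier := C\<rparr>) X)"

lemma ex_witnesses:
  assumes A: "is_ualgebra \<Sigma> A" and X: "X \<subseteq> carrier A \<times> carrier A"
    and xy: "(x, y) \<in> cgen \<Sigma> A X"
  shows "\<exists>Y. witnesses \<Sigma> A X x y Y"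
proof -
  define R where "R = {(x, y). x \<in> carrier A \<and> y \<in> carrier A \<and> (\<exists>Y. witnesses \<Sigma> A X x y Y)}"
  have cong: "congruence \<Sigma> (A\<lparr>carrier := C\<rparr>) (cgen \<Sigma> (A\<lparr>carrier := C\<rparr>) X)"
    if "subuniverse \<Sigma> A C" "X \<subseteq> C \<times> C" for C
    using that by (intro cgen_congruence) (auto simp: subuniverse_def)
  have eq: "equiv C (cgen \<Sigma> (A\<lparr>carrier := C\<rparr>) X)"
    if "subuniverse \<Sigma> A C" "X \<subseteq> C \<times> C" for C
    using cong[OF that] by (simp add: congruence_def)
  have "congruence \<Sigma> A R"
    unfolding congruence_def
  proof (intro conjI ballI allI impI)
    show "equiv (carrier A) R"
    proof (rule equivI)
      show "R \<subseteq> carrier A \<times> carrier A" by (auto simp: R_def)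
      show "refl_on (carrier A) R"
      proof (rule refl_onI)
        fix x assume x: "x \<in> carrier A"
        have "witnesses \<Sigma> A X x x {x}"
          unfolding witnesses_def using x eq by (auto simp: equiv_def refl_on_def)
        then show "(x, x) \<in> R" using x by (auto simp: R_def)
      qed
      show "sym R"
      proof (rule symI)
        fix x y assume "(x, y) \<in> R"
        then obtain Y where Y: "x \<in> carrier A" "y \<in> carrier A" "witnesses \<Sigma> A X x y Y"
          by (auto simp: R_def)
        have "witnesses \<Sigma> A X y x Y"
          using Y(3) eq unfolding witnesses_def by (meson equiv_def symD)
        then show "(y, x) \<in> R" using Y by (auto simp: R_def)
      qed
      show "trans R"
      proof (rule transI)
        fix x y z assume "(x, y) \<in> R" "(y, z) \<in> R"
        then obtain Y Z where Y: "x \<in> carrier A" "z \<in> carrier A"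
            "witnesses \<Sigma> A X x y Y" "witnesses \<Sigma> A X y z Z"
          by (auto simp: R_def)
        have "(x, z) \<in> cgen \<Sigma> (A\<lparr>carrier := C\<rparr>) X"
          if "subuniverse \<Sigma> A C" "X \<subseteq> C \<times> C" "Y \<union> Z \<subseteq> C" for C
        proof -
          have "(x, y) \<in> cgen \<Sigma> (A\<lparr>carrier := C\<rparr>) X" "(y, z) \<in> cgen \<Sigma> (A\<lparr>carrier := C\<rparr>) X"
            using Y(3,4) that unfolding witnesses_def by simp_all
          then show ?thesis using eq[OF that(1,2)] by (meson equiv_def transD)
        qed
        then have "witnesses \<Sigma> A X x z (Y \<union> Z)"
          using Y(3,4) unfolding witnesses_def by simp
        then show "(x, z) \<in> R" using Y by (auto simp: R_def)
      qed
    qed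
  next
    fix f xs ys
    assume f: "f \<in> symbols \<Sigma>"
      and "length xs = arity \<Sigma> f \<and> length ys = arity \<Sigma> f \<and> list_all2 (\<lambda>x y. (x, y) \<in> R) xs ys"
    then have len: "length xs = arity \<Sigma> f" "length ys = arity \<Sigma> f"
      and l: "\<And>k. k < arity \<Sigma> f \<Longrightarrow> (xs ! k, ys ! k) \<in> R"
      by (auto simp: list_all2_conv_all_nth)
    have "\<exists>Y. \<forall>k<arity \<Sigma> f. witnesses \<Sigma> A X (xs ! k) (ys ! k) (Y k)"
      using l by (auto simp: R_def intro: choice)
    then obtain Y where Y: "\<And>k. k < arity \<Sigma> f \<Longrightarrow> witnesses \<Sigma> A X (xs ! k) (ys ! k) (Y k)"
      by blast
    have "(ops A f xs, ops A f ys) \<in> cgen \<Sigma> (A\<lparr>carrier := C\<rparr>) X"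
      if C: "subuniverse \<Sigma> A C" "X \<subseteq> C \<times> C" "(\<Union>k<arity \<Sigma> f. Y k) \<subseteq> C" for C
    proof -
      have "(xs ! k, ys ! k) \<in> cgen \<Sigma> (A\<lparr>carrier := C\<rparr>) X" if "k < arity \<Sigma> f" for k
        using Y[OF that] C that unfolding witnesses_def by blast
      then have "list_all2 (\<lambda>x y. (x, y) \<in> cgen \<Sigma> (A\<lparr>carrier := C\<rparr>) X) xs ys"
        using len by (auto simp: list_all2_conv_all_nth)
      then show ?thesis
        using cong[OF C(1,2)] f len by (auto simp: congruence_def)
    qed
    then have "witnesses \<Sigma> A X (ops A f xs) (ops A f ys) (\<Union>k<arity \<Sigma> f. Y k)"
      using Y unfolding witnesses_def by blast
    moreover have "set xs \<subseteq> carrier A" "set ys \<subseteq> carrier A"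
      using l len by (auto simp: R_def in_set_conv_nth)
    then have "ops A f xs \<in> carrier A" "ops A f ys \<in> carrier A"
      using A f len by (auto simp: is_ualgebra_def)
    ultimately show "(ops A f xs, ops A f ys) \<in> R" by (auto simp: R_def)
  qed
  moreover have "X \<subseteq> R"
  proof (rule subrelI)
    fix x y assume "(x, y) \<in> X"
    then have "witnesses \<Sigma> A X x y {}"
      using cgen_superset unfolding witnesses_def by fast
    then show "(x, y) \<in> R" using X \<open>(x, y) \<in> X\<close> by (auto simp: R_def)
  qed
  ultimately have "cgen \<Sigma> A X \<subseteq> R" by (rule cgen_least)
  then have "(x, y) \<in> R" using xy by (rule subsetD)
  then show ?thesis by (simp add: R_def)
qed

lemma witnesses_mono:
  "witnesses \<Sigma> A X x y Y \<Longrightarrow> Y \<subseteq> Z \<Longrightarrow> finite Z \<Longrightarrow> Z \<subseteq> carrier A \<Longrightarrow> witnesses \<Sigma> A X x y Z"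
  unfolding witnesses_def by (meson subset_trans)

lemma ex_witness_list:
  assumes A: "is_ualgebra \<Sigma> A" and vs: "set vs \<subseteq> carrier A"
  shows "\<exists>ws. set ws \<subseteq> carrier A \<and>
    (\<forall>X \<subseteq> set vs \<times> set vs. \<forall>x \<in> set vs. \<forall>y \<in> set vs. (x, y) \<in> cgen \<Sigma> A X \<longrightarrow>
      witnesses \<Sigma> A X x y (set ws))"
proof -
  define T where "T = {(X, x, y). X \<subseteq> set vs \<times> set vs \<and> x \<in> set vs \<and> y \<in> set vs \<and>
    (x, y) \<in> cgen \<Sigma> A X}"
  have "T \<subseteq> Pow (set vs \<times> set vs) \<times> set vs \<times> set vs" by (auto simp: T_def)
  then have T: "finite T" by (rule finite_subset) simp
  have "\<forall>p \<in> T. \<exists>Y. witnesses \<Sigma> A (fst p) (fst (snd p)) (snd (snd p)) Y"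
    using vs by (auto simp: T_def intro!: ex_witnesses[OF A])
  then obtain Y where "\<forall>p \<in> T. witnesses \<Sigma> A (fst p) (fst (snd p)) (snd (snd p)) (Y p)"
    by (rule bchoice[THEN exE])
  then have Y: "witnesses \<Sigma> A (fst p) (fst (snd p)) (snd (snd p)) (Y p)" if "p \<in> T" for p
    using that by blast
  have Y': "finite (Y p)" "Y p \<subseteq> carrier A" if "p \<in> T" for p
    using Y[OF that] by (simp_all add: witnesses_def)
  have fin: "finite (\<Union>(Y ` T))" using T Y'(1) by simp
  obtain ws where ws: "set ws = \<Union>(Y ` T)" using finite_list[OF fin] by (rule exE)
  have wsA: "set ws \<subseteq> carrier A" unfolding ws using Y'(2) by (rule UN_least)
  have "witnesses \<Sigma> A X x y (set ws)" if "(X, x, y) \<in> T" for X x y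
  proof (rule witnesses_mono)
    show "witnesses \<Sigma> A X x y (Y (X, x, y))" using Y[OF that] by simp
    show "Y (X, x, y) \<subseteq> set ws" unfolding ws using that by (rule UN_upper)
  qed (simp_all add: wsA)
  then have "\<forall>X \<subseteq> set vs \<times> set vs. \<forall>x \<in> set vs. \<forall>y \<in> set vs. (x, y) \<in> cgen \<Sigma> A X \<longrightarrow>
      witnesses \<Sigma> A X x y (set ws)"
    by (simp add: T_def)
  then show ?thesis using wsA by (intro exI[of _ ws] conjI)
qed

primrec name_val ::
  "('i \<Rightarrow> ('f, 'a) ualgebra) \<Rightarrow> ('i \<Rightarrow> 'i \<Rightarrow> 'a \<Rightarrow> 'a) \<Rightarrow> ('i \<Rightarrow> 's \<Rightarrow> 'a list) \<Rightarrow>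
   ('i \<Rightarrow> 'a list \<Rightarrow> 'a list) \<Rightarrow> ('i, 's, 'f) elem_name \<Rightarrow> 'a" where
  "name_val E e G W (Gen i s k) = G i s ! k"
| "name_val E e G W (App i f ts) = ops (E i) f (map (name_val E e G W) ts)"
| "name_val E e G W (Arr i j t) = e i j (name_val E e G W t)"
| "name_val E e G W (Wit i k ts) = W i (map (name_val E e G W) ts) ! k"

inductive is_name ::
  "'f similarity_type \<Rightarrow> 'i gorder \<Rightarrow> ('i \<Rightarrow> 's gorder) \<Rightarrow> ('i \<Rightarrow> ('f, 'a) ualgebra) \<Rightarrow>
   ('i \<Rightarrow> 'i \<Rightarrow> 'a \<Rightarrow> 'a) \<Rightarrow> ('i \<Rightarrow> 's \<Rightarrow> 'a list) \<Rightarrow> ('i \<Rightarrow> 'a list \<Rightarrow> 'a list) \<Rightarrow>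
   'i \<Rightarrow> ('i, 's, 'f) elem_name \<Rightarrow> bool"
  for \<Sigma> I D E e G W where
  gen: "i \<in> carrier I \<Longrightarrow> s \<in> carrier (D i) \<Longrightarrow> k < length (G i s) \<Longrightarrow>
    is_name \<Sigma> I D E e G W i (Gen i s k)"
| app: "i \<in> carrier I \<Longrightarrow> f \<in> symbols \<Sigma> \<Longrightarrow> length ts = arity \<Sigma> f \<Longrightarrow>
    (\<And>t. t \<in> set ts \<Longrightarrow> is_name \<Sigma> I D E e G W i t) \<Longrightarrow> is_name \<Sigma> I D E e G W i (App i f ts)"
| arr: "i \<in> carrier I \<Longrightarrow> j \<in> carrier I \<Longrightarrow> i \<sqsubseteq>\<^bsub>I\<^esub> j \<Longrightarrow> is_name \<Sigma> I D E e G W i t \<Longrightarrow>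
    is_name \<Sigma> I D E e G W j (Arr i j t)"
| wit: "i \<in> carrier I \<Longrightarrow> (\<And>t. t \<in> set ts \<Longrightarrow> is_name \<Sigma> I D E e G W i t) \<Longrightarrow>
    k < length (W i (map (name_val E e G W) ts)) \<Longrightarrow> is_name \<Sigma> I D E e G W i (Wit i k ts)"

theorem is_lifting_imp_has_lifting:
  fixes E :: "'i \<Rightarrow> ('f, 'a) ualgebra" and D :: "'i \<Rightarrow> 's gorder"
  assumes lift: "is_lifting \<Sigma> I D d E e"
  shows "has_lifting \<Sigma> I D d"
proof -
  have alg: "is_ualgebra \<Sigma> (E i)" if "i \<in> carrier I" for i
    using lift that by (auto simp: is_lifting_def poset_functor_def)
  have hom: "e i j \<in> ualg_hom \<Sigma> (E i) (E j)"
    if "i \<in> carrier I" "j \<in> carrier I" "i \<sqsubseteq>\<^bsub>I\<^esub> j" for i j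
    using lift that by (auto simp: is_lifting_def poset_functor_def)
  have e_id: "e i i x = x" if "i \<in> carrier I" "x \<in> carrier (E i)" for i x
    using lift that by (auto simp: is_lifting_def poset_functor_def)
  have e_comp: "e j k (e i j x) = e i k x"
    if "i \<in> carrier I" "j \<in> carrier I" "k \<in> carrier I" "i \<sqsubseteq>\<^bsub>I\<^esub> j" "j \<sqsubseteq>\<^bsub>I\<^esub> k" "x \<in> carrier (E i)"
    for i j k x
    using lift that by (simp add: is_lifting_def poset_functor_def)
  obtain \<eta> where \<eta>: "\<And>i. i \<in> carrier I \<Longrightarrow> \<eta> i \<in> slat_iso (Con_c \<Sigma> (E i)) (D i)"
    and nat: "\<And>i j \<alpha>. i \<in> carrier I \<Longrightarrow> j \<in> carrier I \<Longrightarrow> i \<sqsubseteq>\<^bsub>I\<^esub> j \<Longrightarrow> \<alpha> \<in> carrier (Con_c \<Sigma> (E i)) \<Longrightarrow>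
      \<eta> j (Con_c_map \<Sigma> (E j) (e i j) \<alpha>) = d i j (\<eta> i \<alpha>)"
    using lift unfolding is_lifting_def by blast

  have "\<exists>vs. set vs \<subseteq> carrier (E i) \<and> (\<exists>X \<subseteq> set vs \<times> set vs. s = \<eta> i (cgen \<Sigma> (E i) X))"
    if i: "i \<in> carrier I" and s: "s \<in> carrier (D i)" for i s
  proof -
    obtain \<alpha> where "\<alpha> \<in> carrier (Con_c \<Sigma> (E i))" and s\<alpha>: "s = \<eta> i \<alpha>"
      using \<eta>[OF i] s unfolding slat_iso_def bij_betw_def by blast
    then obtain X where X: "finite X" "X \<subseteq> carrier (E i) \<times> carrier (E i)" "\<alpha> = cgen \<Sigma> (E i) X"
      by (elim carrier_Con_cE)
    obtain vs where vs: "set vs = fst ` X \<union> snd ` X"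
      using X(1) finite_list by (metis finite_UnI finite_imageI)
    have "set vs \<subseteq> carrier (E i)" "X \<subseteq> set vs \<times> set vs"
      using X(2) unfolding vs by force+
    then show ?thesis using s\<alpha> X(3) by blast
  qed
  then obtain G where
    G: "\<And>i s. i \<in> carrier I \<Longrightarrow> s \<in> carrier (D i) \<Longrightarrow> set (G i s) \<subseteq> carrier (E i)"
      "\<And>i s. i \<in> carrier I \<Longrightarrow> s \<in> carrier (D i) \<Longrightarrow>
        \<exists>X \<subseteq> set (G i s) \<times> set (G i s). s = \<eta> i (cgen \<Sigma> (E i) X)"
    by metis

  have "\<exists>ws. set ws \<subseteq> carrier (E i) \<and>
    (\<forall>X \<subseteq> set vs \<times> set vs. \<forall>x \<in> set vs. \<forall>y \<in> set vs. (x, y) \<in> cgen \<Sigma> (E i) X \<longrightarrow>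
      witnesses \<Sigma> (E i) X x y (set ws))"
    if "i \<in> carrier I" "set vs \<subseteq> carrier (E i)" for i vs
    using that by (intro ex_witness_list alg)
  then have "\<exists>W. \<forall>i vs. i \<in> carrier I \<longrightarrow> set vs \<subseteq> carrier (E i) \<longrightarrow> set (W i vs) \<subseteq> carrier (E i) \<and>
    (\<forall>X \<subseteq> set vs \<times> set vs. \<forall>x \<in> set vs. \<forall>y \<in> set vs. (x, y) \<in> cgen \<Sigma> (E i) X \<longrightarrow>
      witnesses \<Sigma> (E i) X x y (set (W i vs)))"
    by (intro choice allI) blast
  then obtain W where
    W: "\<And>i vs. i \<in> carrier I \<Longrightarrow> set vs \<subseteq> carrier (E i) \<Longrightarrow> set (W i vs) \<subseteq> carrier (E i)"
      "\<And>i vs X x y. i \<in> carrier I \<Longrightarrow> set vs \<subseteq> carrier (E i) \<Longrightarrow> X \<subseteq> set vs \<times> set vs \<Longrightarrow>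
        x \<in> set vs \<Longrightarrow> y \<in> set vs \<Longrightarrow> (x, y) \<in> cgen \<Sigma> (E i) X \<Longrightarrow>
        witnesses \<Sigma> (E i) X x y (set (W i vs))"
    by (metis (no_types))

  define val where "val = name_val E e G W"
  define nm where "nm = is_name \<Sigma> I D E e G W"
  define B where "B i = {val t | t. nm i t}" for i
  define c where "c i x = (SOME t. nm i t \<and> val t = x)" for i x
  define U where "U i = c i ` B i" for i

  have val_in: "i \<in> carrier I \<and> val t \<in> carrier (E i)" if "nm i t" for i t
    using that unfolding nm_def
  proof (induction rule: is_name.induct)
    case (gen i s k)
    then show ?case using G(1)[of i s] by (auto simp: val_def)
  next
    case (app i f ts)
    then have "set (map val ts) \<subseteq> carrier (E i)" "length (map val ts) = arity \<Sigma> f" by auto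
    then have "ops (E i) f (map val ts) \<in> carrier (E i)"
      using alg[OF \<open>i \<in> carrier I\<close>] \<open>f \<in> symbols \<Sigma>\<close> unfolding is_ualgebra_def by blast
    then show ?case using app by (simp add: val_def)
  next
    case (arr i j t)
    then show ?case using hom[of i j] by (auto simp: val_def ualg_hom_def)
  next
    case (wit i ts k)
    then have "set (map val ts) \<subseteq> carrier (E i)" by auto
    then have "set (W i (map val ts)) \<subseteq> carrier (E i)" using wit by (intro W(1))
    then show ?case using wit by (auto simp: val_def)
  qed
  have B_sub: "B i \<subseteq> carrier (E i)" for i
    using val_in by (auto simp: B_def)
  have c: "nm i (c i x) \<and> val (c i x) = x" if "x \<in> B i" for i x
  proof -
    have "\<exists>t. nm i t \<and> val t = x" using that by (auto simp: B_def)
    then show ?thesis unfolding c_def by (rule someI_ex)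
  qed
  have B_ops: "ops (E i) f xs \<in> B i"
    if i: "i \<in> carrier I" and f: "f \<in> symbols \<Sigma>" "length xs = arity \<Sigma> f" "set xs \<subseteq> B i" for i f xs
  proof -
    have "map val (map (c i) xs) = xs"
      using f(3) c by (auto intro!: map_idI)
    moreover have "nm i (App i f (map (c i) xs))"
      unfolding nm_def by (rule is_name.app) (use i f c in \<open>auto simp: nm_def\<close>)
    moreover have "val (App i f (map (c i) xs)) = ops (E i) f (map val (map (c i) xs))"
      by (simp add: val_def)
    ultimately show ?thesis unfolding B_def by (metis (mono_tags, lifting) mem_Collect_eq)
  qed
  have B_alg: "is_ualgebra \<Sigma> (E i\<lparr>carrier := B i\<rparr>)" and B_subu: "subuniverse \<Sigma> (E i) (B i)"
    if "i \<in> carrier I" for i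
    using B_ops[OF that] B_sub by (auto simp: is_ualgebra_def subuniverse_def)
  have B_arr: "e i j x \<in> B j" if "i \<in> carrier I" "j \<in> carrier I" "i \<sqsubseteq>\<^bsub>I\<^esub> j" "x \<in> B i" for i j x
  proof -
    have "nm j (Arr i j (c i x))"
      unfolding nm_def by (rule is_name.arr) (use that c in \<open>auto simp: nm_def\<close>)
    moreover have "val (Arr i j (c i x)) = e i j x" using c[OF that(4)] by (simp add: val_def)
    ultimately show ?thesis unfolding B_def by (metis (mono_tags, lifting) mem_Collect_eq)
  qed
  have B_wit: "(x, y) \<in> cgen \<Sigma> (E i\<lparr>carrier := B i\<rparr>) X"
    if i: "i \<in> carrier I" and X: "finite X" "X \<subseteq> B i \<times> B i" and xy: "x \<in> B i" "y \<in> B i"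
      "(x, y) \<in> cgen \<Sigma> (E i) X" for i x y X
  proof -
    obtain vs where vs: "set vs = fst ` X \<union> snd ` X \<union> {x, y}"
      using X(1) finite_list by (metis finite.emptyI finite.insertI finite_UnI finite_imageI)
    have vsB: "set vs \<subseteq> B i" using X(2) xy unfolding vs by auto
    have mv: "map val (map (c i) vs) = vs"
      using vsB c by (auto intro!: map_idI)
    have "set (W i vs) \<subseteq> B i"
    proof
      fix w assume "w \<in> set (W i vs)"
      then obtain k where k: "k < length (W i vs)" "w = W i vs ! k"
        by (auto simp: in_set_conv_nth)
      have "nm i (Wit i k (map (c i) vs))"
        unfolding nm_def
        by (rule is_name.wit) (use i k vsB c mv in \<open>auto simp: nm_def val_def\<close>)
      moreover have "val (Wit i k (map (c i) vs)) = W i (map val (map (c i) vs)) ! k"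
        by (simp add: val_def)
      ultimately show "w \<in> B i" unfolding B_def k(2) mv by (metis (mono_tags, lifting) mem_Collect_eq)
    qed
    moreover have Xvs: "X \<subseteq> set vs \<times> set vs" unfolding vs by force
    have "x \<in> set vs" "y \<in> set vs" by (simp_all add: vs)
    then have "witnesses \<Sigma> (E i) X x y (set (W i vs))"
      using xy(3) by (rule W(2)[OF i subset_trans[OF vsB B_sub] Xvs])
    ultimately show ?thesis
      using B_subu[OF i] X(2) unfolding witnesses_def by blast
  qed

  define F where "F i = \<lparr>carrier = U i, ops = (\<lambda>f ts. c i (ops (E i) f (map val ts)))\<rparr>" for i
  define u where "u i j t = c j (e i j (val t))" for i j t
  have valU: "val t \<in> B i \<and> c i (val t) = t" if "t \<in> U i" for i t
    using that c by (auto simp: U_def)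
  have valU_set: "val ` set ts \<subseteq> B i" if "set ts \<subseteq> U i" for i ts
    using that valU by blast
  have val_E: "val t \<in> carrier (E i)" if "t \<in> U i" for i t
    using valU[OF that] B_sub by blast
  have valc: "val (c i x) = x" if "x \<in> B i" for i x
    using c[OF that] by simp
  have cU: "c i x \<in> U i" if "x \<in> B i" for i x using that by (auto simp: U_def)
  have F_alg: "is_ualgebra \<Sigma> (F i)" if i: "i \<in> carrier I" for i
  proof -
    have "c i (ops (E i) f (map val ts)) \<in> U i"
      if "f \<in> symbols \<Sigma>" "length ts = arity \<Sigma> f" "set ts \<subseteq> U i" for f ts
      using that valU_set by (intro cU B_ops[OF i]) simp_all
    then show ?thesis by (simp add: is_ualgebra_def F_def)
  qed
  have val_hom: "val \<in> ualg_hom \<Sigma> (F i) (E i)" if i: "i \<in> carrier I" for i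
  proof -
    have "val (c i (ops (E i) f (map val ts))) = ops (E i) f (map val ts)"
      if "f \<in> symbols \<Sigma>" "length ts = arity \<Sigma> f" "set ts \<subseteq> U i" for f ts
      using that valU_set by (intro conjunct2[OF c] B_ops[OF i]) simp_all
    then show ?thesis using val_E by (auto simp: ualg_hom_def F_def)
  qed
  have c_hom: "c i \<in> ualg_hom \<Sigma> (E i\<lparr>carrier := B i\<rparr>) (F i)" if i: "i \<in> carrier I" for i
  proof -
    have "map (val \<circ> c i) xs = xs" if "set xs \<subseteq> B i" for xs
      using that c by (auto intro!: map_idI)
    then show ?thesis using cU by (auto simp: ualg_hom_def F_def)
  qed
  have F_fun: "ualg_diagram \<Sigma> I F u"
    unfolding poset_functor_def
  proof (intro conjI ballI impI)
    fix i j assume ij: "i \<in> carrier I" "j \<in> carrier I" "i \<sqsubseteq>\<^bsub>I\<^esub> j"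
    have "u i j (ops (F i) f ts) = ops (F j) f (map (u i j) ts)"
      if f: "f \<in> symbols \<Sigma>" "length ts = arity \<Sigma> f" "set ts \<subseteq> U i" for f ts
    proof -
      have tB: "set (map val ts) \<subseteq> B i" using f(3) valU by auto
      have "val (c i (ops (E i) f (map val ts))) = ops (E i) f (map val ts)"
        by (intro conjunct2[OF c] B_ops[OF ij(1)]) (use f tB in auto)
      moreover have "e i j (ops (E i) f (map val ts)) = ops (E j) f (map (e i j) (map val ts))"
      proof -
        have "set (map val ts) \<subseteq> carrier (E i)" "length (map val ts) = arity \<Sigma> f"
          using tB B_sub f(2) by (blast, simp)
        then show ?thesis using hom[OF ij] f(1) unfolding ualg_hom_def by blast
      qed
      moreover have "map val (map (u i j) ts) = map (e i j) (map val ts)"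
        using tB by (auto simp: u_def intro!: valc B_arr[OF ij])
      ultimately show ?thesis by (simp add: u_def F_def del: map_map)
    qed
    moreover have "u i j t \<in> U j" if "t \<in> U i" for t
      unfolding u_def using valU[OF that] by (intro cU B_arr[OF ij]) simp
    ultimately show "u i j \<in> ualg_hom \<Sigma> (F i) (F j)"
      by (simp add: ualg_hom_def F_def)
  next
    fix i x assume "i \<in> carrier I" "x \<in> carrier (F i)"
    then show "u i i x = x"
      using valU[of x i] B_sub[of i] e_id[of i "val x"] by (auto simp: u_def F_def)
  next
    fix i j k assume ijk: "i \<in> carrier I" "j \<in> carrier I" "k \<in> carrier I" "i \<sqsubseteq>\<^bsub>I\<^esub> j \<and> j \<sqsubseteq>\<^bsub>I\<^esub> k"
    fix x assume "x \<in> carrier (F i)"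
    then have x: "val x \<in> B i" using valU by (auto simp: F_def)
    have "val (c j (e i j (val x))) = e i j (val x)"
      by (intro conjunct2[OF c] B_arr) (use ijk x in auto)
    then show "u j k (u i j x) = u i k x"
      using e_comp[of i j k "val x"] ijk subsetD[OF B_sub x] by (auto simp: u_def)
  qed (rule F_alg)

  define \<rho> where "\<rho> i = Con_c_map \<Sigma> (E i) val" for i
  have \<rho>_cgen: "\<rho> i (cgen \<Sigma> (F i) X) = cgen \<Sigma> (E i) (map_prod val val ` X)"
    if "i \<in> carrier I" "X \<subseteq> carrier (F i) \<times> carrier (F i)" for i X
    unfolding \<rho>_def using that by (intro Con_c_map_cgen F_alg alg val_hom)
  have \<rho>_hom: "\<rho> i \<in> slat_hom (Con_c \<Sigma> (F i)) (Con_c \<Sigma> (E i))" if "i \<in> carrier I" for i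
    unfolding \<rho>_def using that by (intro Con_c_map_slat_hom F_alg alg val_hom)
  have \<rho>_le: "cgen \<Sigma> (F i) X \<subseteq> cgen \<Sigma> (F i) Y"
    if i: "i \<in> carrier I" and X: "X \<subseteq> U i \<times> U i" and Y: "Y \<subseteq> U i \<times> U i" "finite Y"
      and le: "cgen \<Sigma> (E i) (map_prod val val ` X) \<subseteq> cgen \<Sigma> (E i) (map_prod val val ` Y)" for i X Y
  proof (rule cgen_least)
    show "congruence \<Sigma> (F i) (cgen \<Sigma> (F i) Y)"
      using Y by (intro cgen_congruence F_alg i) (auto simp: F_def)
    show "X \<subseteq> cgen \<Sigma> (F i) Y"
    proof (rule subrelI)
      fix a b assume ab: "(a, b) \<in> X"
      then have abU: "a \<in> U i" "b \<in> U i" using X by auto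
      have Y': "map_prod val val ` Y \<subseteq> B i \<times> B i" using Y valU by fastforce
      have "(val a, val b) \<in> cgen \<Sigma> (E i) (map_prod val val ` X)"
        using ab by (intro subsetD[OF cgen_superset]) force
      then have "(val a, val b) \<in> cgen \<Sigma> (E i\<lparr>carrier := B i\<rparr>) (map_prod val val ` Y)"
        using le Y Y' valU abU by (intro B_wit[OF i]) auto
      then have "map_prod (c i) (c i) (val a, val b) \<in>
          map_prod (c i) (c i) ` cgen \<Sigma> (E i\<lparr>carrier := B i\<rparr>) (map_prod val val ` Y)"
        by (rule imageI)
      then have "map_prod (c i) (c i) (val a, val b) \<in>
          cgen \<Sigma> (F i) (map_prod (c i) (c i) ` map_prod val val ` Y)"
        by (rule subsetD[OF cgen_hom[OF B_alg[OF i] F_alg[OF i] c_hom[OF i]], rotated]) (simp add: Y')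
      moreover have "map_prod (c i) (c i) ` map_prod val val ` Y = Y"
        using Y(1) valU by (intro map_prod_image_cancel[of "U i"]) simp_all
      ultimately show "(a, b) \<in> cgen \<Sigma> (F i) Y" using valU abU by simp
    qed
  qed
  have \<rho>_bij: "bij_betw (\<rho> i) (carrier (Con_c \<Sigma> (F i))) (carrier (Con_c \<Sigma> (E i)))"
    if i: "i \<in> carrier I" for i
    unfolding bij_betw_def
  proof
    show "inj_on (\<rho> i) (carrier (Con_c \<Sigma> (F i)))"
    proof (rule inj_onI)
      fix \<alpha> \<beta> assume "\<alpha> \<in> carrier (Con_c \<Sigma> (F i))" "\<beta> \<in> carrier (Con_c \<Sigma> (F i))" and eq: "\<rho> i \<alpha> = \<rho> i \<beta>"
      then obtain X Y where X: "finite X" "X \<subseteq> carrier (F i) \<times> carrier (F i)" "\<alpha> = cgen \<Sigma> (F i) X"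
        and Y: "finite Y" "Y \<subseteq> carrier (F i) \<times> carrier (F i)" "\<beta> = cgen \<Sigma> (F i) Y"
        by (elim carrier_Con_cE)
      have "cgen \<Sigma> (E i) (map_prod val val ` X) = cgen \<Sigma> (E i) (map_prod val val ` Y)"
        using eq unfolding X(3) Y(3) \<rho>_cgen[OF i X(2)] \<rho>_cgen[OF i Y(2)] .
      then show "\<alpha> = \<beta>"
        unfolding X(3) Y(3) using X Y by (intro subset_antisym \<rho>_le[OF i]) (auto simp: F_def)
    qed
    show "\<rho> i ` carrier (Con_c \<Sigma> (F i)) = carrier (Con_c \<Sigma> (E i))"
    proof
      show "\<rho> i ` carrier (Con_c \<Sigma> (F i)) \<subseteq> carrier (Con_c \<Sigma> (E i))"
        using \<rho>_hom[OF i] by (auto simp: slat_hom_def)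
      show "carrier (Con_c \<Sigma> (E i)) \<subseteq> \<rho> i ` carrier (Con_c \<Sigma> (F i))"
      proof
        fix \<alpha> assume \<alpha>: "\<alpha> \<in> carrier (Con_c \<Sigma> (E i))"
        define s where "s = \<eta> i \<alpha>"
        have s: "s \<in> carrier (D i)" using \<eta>[OF i] \<alpha> by (auto simp: s_def slat_iso_def slat_hom_def)
        obtain X where X: "X \<subseteq> set (G i s) \<times> set (G i s)" "s = \<eta> i (cgen \<Sigma> (E i) X)"
          using G(2)[OF i s] by blast
        have fX: "finite X" using X(1) by (rule finite_subset) simp
        have "cgen \<Sigma> (E i) X \<in> carrier (Con_c \<Sigma> (E i))"
          using X(1) G(1)[OF i s] fX by (intro cgen_in_Con_c) blast+
        then have \<alpha>X: "\<alpha> = cgen \<Sigma> (E i) X"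
          using \<eta>[OF i] X(2) \<alpha> unfolding s_def slat_iso_def bij_betw_def inj_on_def by blast
        have GB: "set (G i s) \<subseteq> B i"
        proof
          fix w assume "w \<in> set (G i s)"
          then obtain k where k: "k < length (G i s)" "w = G i s ! k"
            by (auto simp: in_set_conv_nth)
          have "nm i (Gen i s k)" unfolding nm_def by (rule is_name.gen) (use i s k in auto)
          moreover have "val (Gen i s k) = w" by (simp add: val_def k)
          ultimately show "w \<in> B i" unfolding B_def by blast
        qed
        define Y where "Y = map_prod (c i) (c i) ` X"
        have XB: "X \<subseteq> B i \<times> B i" using X(1) GB by blast
        have Y: "finite Y" "Y \<subseteq> carrier (F i) \<times> carrier (F i)"
          using fX XB cU by (auto simp: Y_def F_def)
        have "map_prod val val ` Y = X"
          unfolding Y_def using XB valc by (intro map_prod_image_cancel[of "B i"]) simp_all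
        then have "\<alpha> = \<rho> i (cgen \<Sigma> (F i) Y)"
          using \<rho>_cgen[OF i Y(2)] \<alpha>X by simp
        then show "\<alpha> \<in> \<rho> i ` carrier (Con_c \<Sigma> (F i))"
          using cgen_in_Con_c[OF Y] by blast
      qed
    qed
  qed
  have "(\<eta> i \<circ> \<rho> i) \<in> slat_iso (Con_c \<Sigma> (F i)) (D i)" if i: "i \<in> carrier I" for i
  proof -
    have "(\<eta> i \<circ> \<rho> i) \<in> slat_hom (Con_c \<Sigma> (F i)) (D i)"
      using \<rho>_hom[OF i] \<eta>[OF i] by (auto simp: slat_iso_def slat_hom_def Pi_iff)
    moreover have "bij_betw (\<eta> i \<circ> \<rho> i) (carrier (Con_c \<Sigma> (F i))) (carrier (D i))"
      using \<rho>_bij[OF i] \<eta>[OF i] by (auto simp: slat_iso_def intro: bij_betw_trans)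
    ultimately show ?thesis by (simp add: slat_iso_def)
  qed
  moreover have "(\<eta> j \<circ> \<rho> j) (Con_c_map \<Sigma> (F j) (u i j) \<alpha>) = d i j ((\<eta> i \<circ> \<rho> i) \<alpha>)"
    if ij: "i \<in> carrier I" "j \<in> carrier I" "i \<sqsubseteq>\<^bsub>I\<^esub> j" and \<alpha>: "\<alpha> \<in> carrier (Con_c \<Sigma> (F i))" for i j \<alpha>
  proof -
    obtain X where X: "X \<subseteq> carrier (F i) \<times> carrier (F i)" "\<alpha> = cgen \<Sigma> (F i) X"
      using \<alpha> by (rule carrier_Con_cE)
    have u_hom: "u i j \<in> ualg_hom \<Sigma> (F i) (F j)"
      using F_fun ij by (auto simp: poset_functor_def)
    have v: "val (u i j t) = e i j (val t)" if "t \<in> U i" for t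
      unfolding u_def using valU[OF that] by (intro conjunct2[OF c] B_arr ij) auto
    have img: "map_prod val val ` map_prod (u i j) (u i j) ` X =
        map_prod (e i j) (e i j) ` map_prod val val ` X"
      unfolding image_image
    proof (rule image_cong)
      fix p assume "p \<in> X"
      then show "map_prod val val (map_prod (u i j) (u i j) p) =
          map_prod (e i j) (e i j) (map_prod val val p)"
        using X(1) v by (cases p) (auto simp: F_def)
    qed simp
    have "\<rho> j (Con_c_map \<Sigma> (F j) (u i j) \<alpha>) =
        cgen \<Sigma> (E j) (map_prod val val ` map_prod (u i j) (u i j) ` X)"
      unfolding X(2) Con_c_map_cgen[OF F_alg[OF ij(1)] F_alg[OF ij(2)] u_hom X(1)]
      by (rule \<rho>_cgen[OF ij(2) ualg_hom_pairs[OF u_hom X(1)]])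
    also have "\<dots> = Con_c_map \<Sigma> (E j) (e i j) (\<rho> i \<alpha>)"
      unfolding img X(2) \<rho>_cgen[OF ij(1) X(1)]
      by (rule Con_c_map_cgen[OF alg[OF ij(1)] alg[OF ij(2)] hom[OF ij]
            ualg_hom_pairs[OF val_hom[OF ij(1)] X(1)], symmetric])
    finally have "\<rho> j (Con_c_map \<Sigma> (F j) (u i j) \<alpha>) = Con_c_map \<Sigma> (E j) (e i j) (\<rho> i \<alpha>)" .
    moreover have "\<rho> i \<alpha> \<in> carrier (Con_c \<Sigma> (E i))"
      using \<rho>_hom[OF ij(1)] \<alpha> by (auto simp: slat_hom_def)
    ultimately show ?thesis using nat[OF ij] by simp
  qed
  ultimately have "is_lifting \<Sigma> I D d F u"
    unfolding is_lifting_def using F_fun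
    by (intro conjI exI[of _ "\<lambda>i. \<eta> i \<circ> \<rho> i"]) auto
  then show ?thesis unfolding has_lifting_def by blast
qed

end

theory Submission
  imports Defs
begin

text \<open>
  Let \<open>\<Omega>\<close> be a set with more elements than there are finite sequences of operation symbols and
  numbers.  Consider the \<open>\<langle>\<or>,0\<rangle>\<close>-semilattice \<open>S\<close> that has, besides \<open>0\<close> and
  the elements \<open>Span N\<close> for finite \<open>N \<subseteq> \<Omega>\<close>, two \<open>near\<close> and two \<open>far\<close> atoms for every
  \<open>i \<in> \<Omega>\<close>.  All near atoms lie below \<open>\<alpha> = Span {}\<close> and any two of them join to \<open>\<alpha>\<close>.  The two far
  atoms of \<open>i\<close> join to \<open>Span {i}\<close>, which is above \<open>\<alpha>\<close>, but a far atom of \<open>i\<close> is below \<open>Span N\<close>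
  only if \<open>i \<in> N\<close>.  The diagram consists of the subsemilattices \<open>flats P\<close> of the elements that
  mention only indices in \<open>P\<close>, for the finite sets \<open>P \<subseteq> \<Omega>\<close>, with the inclusion maps.  Each of them
  is a finite simple lattice (\<open>flats_copy_simple\<close>).

  Suppose that a lifting \<open>E\<close> exists; the congruence belonging to \<open>s\<close> is denoted by \<open>\<theta> s\<close>.  Write
  \<open>\<theta> \<alpha> = cgen X\<close> with \<open>X\<close> finite, and choose \<open>(x, y) \<in> \<theta> \<alpha>\<close> with \<open>x \<noteq> y\<close>.  For every \<open>i\<close> the
  near atoms of \<open>i\<close> join to \<open>\<alpha>\<close>, so \<open>x\<close> is identified with some \<open>v\<^sub>i \<noteq> x\<close> by one of
  them, and this \<open>v\<^sub>i\<close> is reached from \<open>x\<close> by a Mal'cev chain of images of pairs in \<open>X\<close> under unary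
  polynomials.  Apart from its parameters, the chain is described by a finite amount of data over
  the set of operation symbols.  As \<open>\<Omega>\<close> is large, two distinct \<open>i\<close> and \<open>j\<close> have chains with the
  same description (\<open>no_inj_into_schemes\<close>).  All their parameters are identified by one compact
  congruence \<open>\<delta>\<close>, and \<open>\<delta>\<close> mentions only finitely many indices.

  Choose an index \<open>n\<close> that \<open>\<delta>\<close> does not mention.  The far atoms of \<open>n\<close> join to something above
  \<open>\<alpha>\<close>, so after passing to an algebra of the diagram that knows about \<open>n\<close> every pair in \<open>X\<close> is connected by
  steps that lie in far atoms of \<open>n\<close>.  Both chains start at \<open>x\<close>.  After corresponding steps they have
  reached points that are related by \<open>\<delta>\<close> and, if they agreed before, also by a far atom of \<open>n\<close>.
  These two congruences intersect in the identity, so the two chains agree everywhere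
  (\<open>malcev_chain_unique\<close>).  Hence \<open>v\<^sub>i = v\<^sub>j\<close>, and \<open>x\<close> is identified with this element by two
  distinct near atoms, whose meet is \<open>0\<close>.  So \<open>v\<^sub>i = x\<close>, a contradiction.
\<close>

section \<open>Unary polynomials and Mal'cev chains\<close>

definition basic_translation ::
  "'f similarity_type \<Rightarrow> ('f, 'a) ualgebra \<Rightarrow> 'f \<times> nat \<Rightarrow> 'a list \<Rightarrow> bool" where
  "basic_translation \<Sigma> A = (\<lambda>(f, k) c.
    f \<in> symbols \<Sigma> \<and> k < arity \<Sigma> f \<and> length c = arity \<Sigma> f \<and> set c \<subseteq> carrier A)"

text \<open>A unary polynomial is split into a word \<open>w\<close>, which says into which argument places of which
  operations its variable is substituted, and the parameters \<open>cs\<close> that fill the other places.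
  There are few words even if the algebra is large, and this is what makes counting possible.
  The first letter of the word is applied first.  The \<open>k\<close>-th entry of a parameter list is a
  placeholder that is overwritten.\<close>

definition translate ::
  "('f, 'a) ualgebra \<Rightarrow> ('f \<times> nat) list \<Rightarrow> 'a list list \<Rightarrow> 'a \<Rightarrow> 'a" where
  "translate A w cs x = fold (\<lambda>((f, k), c) y. ops A f (c[k := y])) (zip w cs) x"

abbreviation translation ::
  "'f similarity_type \<Rightarrow> ('f, 'a) ualgebra \<Rightarrow> ('f \<times> nat) list \<Rightarrow> 'a list list \<Rightarrow> bool" where
  "translation \<Sigma> A \<equiv> list_all2 (basic_translation \<Sigma> A)"

lemma translate_Nil [simp]: "translate A [] [] x = x"
  by (simp add: translate_def)

lemma translate_Cons [simp]:
  "translate A ((f, k) # w) (c # cs) x = translate A w cs (ops A f (c[k := x]))"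
  by (simp add: translate_def)

lemma translate_snoc:
  "length w = length cs \<Longrightarrow>
    translate A (w @ [(f, k)]) (cs @ [c]) x = ops A f (c[k := translate A w cs x])"
  by (simp add: translate_def)

lemma ops_closed:
  "is_ualgebra \<Sigma> A \<Longrightarrow> f \<in> symbols \<Sigma> \<Longrightarrow> length xs = arity \<Sigma> f \<Longrightarrow> set xs \<subseteq> carrier A \<Longrightarrow>
    ops A f xs \<in> carrier A"
  by (auto simp: is_ualgebra_def)

lemma basic_translation_closed:
  assumes "is_ualgebra \<Sigma> A" "basic_translation \<Sigma> A (f, k) c" "x \<in> carrier A"
  shows "ops A f (c[k := x]) \<in> carrier A"
  using assms set_update_subset_insert[of c k x]
  by (intro ops_closed) (auto simp: basic_translation_def)

lemma translate_closed:
  assumes A: "is_ualgebra \<Sigma> A" and w: "translation \<Sigma> A w cs"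
  shows "x \<in> carrier A \<Longrightarrow> translate A w cs x \<in> carrier A"
  using w
proof (induction arbitrary: x rule: list_all2_induct)
  case (Cons fk w c cs)
  then show ?case
    by (cases fk) (simp add: basic_translation_closed[OF A])
qed simp

lemma congruence_equiv: "congruence \<Sigma> A \<theta> \<Longrightarrow> equiv (carrier A) \<theta>"
  by (simp add: congruence_def)

lemma congruence_refl: "congruence \<Sigma> A \<theta> \<Longrightarrow> x \<in> carrier A \<Longrightarrow> (x, x) \<in> \<theta>"
  by (auto dest!: congruence_equiv simp: equiv_def refl_on_def)

lemma congruence_sym: "congruence \<Sigma> A \<theta> \<Longrightarrow> (x, y) \<in> \<theta> \<Longrightarrow> (y, x) \<in> \<theta>"
  by (auto dest!: congruence_equiv simp: equiv_def sym_def)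

lemma congruence_trans: "congruence \<Sigma> A \<theta> \<Longrightarrow> (x, y) \<in> \<theta> \<Longrightarrow> (y, z) \<in> \<theta> \<Longrightarrow> (x, z) \<in> \<theta>"
  by (auto dest!: congruence_equiv simp: equiv_def trans_def)

lemma congruence_carrier: "congruence \<Sigma> A \<theta> \<Longrightarrow> \<theta> \<subseteq> carrier A \<times> carrier A"
  by (auto dest!: congruence_equiv simp: equiv_def)

lemma translate_cong:
  assumes \<theta>: "congruence \<Sigma> A \<theta>"
  shows "translation \<Sigma> A w cs \<Longrightarrow> translation \<Sigma> A w cs' \<Longrightarrow>
    list_all2 (list_all2 (\<lambda>c c'. (c, c') \<in> \<theta>)) cs cs' \<Longrightarrow> (x, x') \<in> \<theta> \<Longrightarrow>
    (translate A w cs x, translate A w cs' x') \<in> \<theta>"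
proof (induction w arbitrary: cs cs' x x')
  case Nil
  then show ?case by simp
next
  case (Cons fk w)
  obtain f k where fk: "fk = (f, k)" by fastforce
  obtain c ds where cs: "cs = c # ds" "basic_translation \<Sigma> A (f, k) c" "translation \<Sigma> A w ds"
    using Cons.prems(1) by (auto simp: list_all2_Cons1 fk)
  obtain c' ds' where cs': "cs' = c' # ds'" "basic_translation \<Sigma> A (f, k) c'" "translation \<Sigma> A w ds'"
    using Cons.prems(2) by (auto simp: list_all2_Cons1 fk)
  have "list_all2 (\<lambda>c c'. (c, c') \<in> \<theta>) (c[k := x]) (c'[k := x'])"
    using Cons.prems(3,4) by (intro list_all2_update_cong) (auto simp: cs cs')
  then have "(ops A f (c[k := x]), ops A f (c'[k := x'])) \<in> \<theta>"
    using \<theta> cs(2) cs'(2) by (auto simp: congruence_def basic_translation_def)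
  then show ?case
    using Cons.IH[OF cs(3) cs'(3)] Cons.prems(3) by (simp add: cs cs' fk)
qed

lemma translate_cong_arg:
  assumes \<theta>: "congruence \<Sigma> A \<theta>" and w: "translation \<Sigma> A w cs" and xy: "(x, y) \<in> \<theta>"
  shows "(translate A w cs x, translate A w cs y) \<in> \<theta>"
proof (rule translate_cong[OF \<theta> w w _ xy])
  have "set c \<subseteq> carrier A" if "c \<in> set cs" for c
    using w that by (fastforce simp: list_all2_conv_all_nth in_set_conv_nth basic_translation_def)
  then show "list_all2 (list_all2 (\<lambda>c c'. (c, c') \<in> \<theta>)) cs cs"
    using congruence_refl[OF \<theta>] by (intro list.rel_refl_strong) blast
qed

text \<open>The arguments of an operation can be exchanged one after the other, so one argument place at a
  time suffices.\<close>

lemma congruence_if_translations: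
  assumes A: "is_ualgebra \<Sigma> A" and eq: "equiv (carrier A) R"
    and tr: "\<And>f k c x y. basic_translation \<Sigma> A (f, k) c \<Longrightarrow> (x, y) \<in> R \<Longrightarrow>
      (ops A f (c[k := x]), ops A f (c[k := y])) \<in> R"
  shows "congruence \<Sigma> A R"
  unfolding congruence_def
proof (intro conjI ballI allI impI eq)
  fix f xs ys
  assume f: "f \<in> symbols \<Sigma>"
    and "length xs = arity \<Sigma> f \<and> length ys = arity \<Sigma> f \<and> list_all2 (\<lambda>x y. (x, y) \<in> R) xs ys"
  then have len: "length xs = arity \<Sigma> f" "length ys = arity \<Sigma> f"
    and R: "\<And>k. k < arity \<Sigma> f \<Longrightarrow> (xs ! k, ys ! k) \<in> R"
    by (auto simp: list_all2_conv_all_nth)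
  have sub: "R \<subseteq> carrier A \<times> carrier A" using eq by (simp add: equiv_def)
  have "xs ! k \<in> carrier A" "ys ! k \<in> carrier A" if "k < arity \<Sigma> f" for k
    using R[OF that] sub by auto
  then have car: "set xs \<subseteq> carrier A" "set ys \<subseteq> carrier A"
    using len by (auto simp: in_set_conv_nth)
  have "(ops A f xs, ops A f (take k ys @ drop k xs)) \<in> R" if "k \<le> arity \<Sigma> f" for k
    using that
  proof (induction k)
    case 0
    have "ops A f xs \<in> carrier A" using A f len(1) car(1) by (rule ops_closed)
    then show ?case using eq by (simp add: equiv_def refl_on_def)
  next
    case (Suc k)
    let ?c = "take k ys @ drop k xs"
    have k: "k < arity \<Sigma> f" using Suc.prems by simp
    have c: "basic_translation \<Sigma> A (f, k) ?c"
      using f k len car by (auto simp: basic_translation_def dest: in_set_takeD in_set_dropD)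
    have upd: "?c[k := z] = take k ys @ z # drop (Suc k) xs" for z
      using k len Cons_nth_drop_Suc[of k xs] by (metis length_take list_update_length min.absorb4)
    have "?c[k := xs ! k] = ?c"
      using k len Cons_nth_drop_Suc[of k xs] unfolding upd by simp
    moreover have "?c[k := ys ! k] = take (Suc k) ys @ drop (Suc k) xs"
      using k len unfolding upd by (simp add: take_Suc_conv_app_nth)
    ultimately have "(ops A f ?c, ops A f (take (Suc k) ys @ drop (Suc k) xs)) \<in> R"
      using tr[OF c R[OF k]] by simp
    with Suc k show ?case using eq by (auto simp: equiv_def intro: transD)
  qed
  from this[of "arity \<Sigma> f"] show "(ops A f xs, ops A f ys) \<in> R" using len by simp
qed

text \<open>Here too the parameters \<open>css\<close> are kept apart from the scheme \<open>ss\<close>, which lists for each step the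
  position in \<open>X\<close> of the pair that is moved and the word of the polynomial that moves it.\<close>

inductive malcev_chain ::
  "'f similarity_type \<Rightarrow> ('f, 'a) ualgebra \<Rightarrow> ('a \<times> 'a) list \<Rightarrow>
   (nat \<times> ('f \<times> nat) list) list \<Rightarrow> 'a list list list \<Rightarrow> 'a \<Rightarrow> 'a \<Rightarrow> bool"
  for \<Sigma> A X where
    Nil: "x \<in> carrier A \<Longrightarrow> malcev_chain \<Sigma> A X [] [] x x"
  | Cons: "n < length X \<Longrightarrow> X ! n = (a, b) \<Longrightarrow> translation \<Sigma> A w cs \<Longrightarrow>
      malcev_chain \<Sigma> A X ss css (translate A w cs b) y \<Longrightarrow>
      malcev_chain \<Sigma> A X ((n, w) # ss) (cs # css) (translate A w cs a) y"

lemma malcev_chain_append: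
  "malcev_chain \<Sigma> A X ss css x y \<Longrightarrow> malcev_chain \<Sigma> A X ss' css' y z \<Longrightarrow>
    malcev_chain \<Sigma> A X (ss @ ss') (css @ css') x z"
  by (induction rule: malcev_chain.induct) (auto intro: malcev_chain.Cons)

lemma malcev_chain_single:
  assumes "is_ualgebra \<Sigma> A" "set X \<subseteq> carrier A \<times> carrier A"
    "(a, b) \<in> set X" "translation \<Sigma> A w cs"
  shows "\<exists>ss css. malcev_chain \<Sigma> A X ss css (translate A w cs a) (translate A w cs b)"
proof -
  obtain n where n: "n < length X" "X ! n = (a, b)" using assms(3) by (auto simp: in_set_conv_nth)
  have "translate A w cs b \<in> carrier A" using assms by (auto intro: translate_closed)
  then show ?thesis using malcev_chain.Cons[OF n assms(4) malcev_chain.Nil] by blast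
qed

lemma malcev_chain_translate:
  assumes A: "is_ualgebra \<Sigma> A" and f: "basic_translation \<Sigma> A (f, k) c"
  shows "malcev_chain \<Sigma> A X ss css x y \<Longrightarrow>
    \<exists>ss css. malcev_chain \<Sigma> A X ss css (ops A f (c[k := x])) (ops A f (c[k := y]))"
proof (induction rule: malcev_chain.induct)
  case (Nil x)
  then show ?case using basic_translation_closed[OF A f] by (blast intro: malcev_chain.Nil)
next
  case (Cons n a b w cs ss css y)
  from Cons.IH obtain ss css where
    "malcev_chain \<Sigma> A X ss css (ops A f (c[k := translate A w cs b])) (ops A f (c[k := y]))" by blast
  moreover have "translation \<Sigma> A (w @ [(f, k)]) (cs @ [c])"
    using Cons.hyps(3) f by (simp add: list_all2_appendI)
  ultimately show ?case
    using malcev_chain.Cons[OF Cons.hyps(1,2), of \<Sigma> A "w @ [(f, k)]" "cs @ [c]" ss css]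
      list_all2_lengthD[OF Cons.hyps(3)] by (auto simp: translate_snoc)
qed

text \<open>Mal'cev's description of generated congruences.  Symmetry of \<open>X\<close> allows the steps of a chain to
  go in one direction only.\<close>

lemma ex_malcev_chain:
  assumes A: "is_ualgebra \<Sigma> A" and X: "set X \<subseteq> carrier A \<times> carrier A" "sym (set X)"
    and xy: "(x, y) \<in> cgen \<Sigma> A (set X)"
  shows "\<exists>ss css. malcev_chain \<Sigma> A X ss css x y"
proof -
  define R where "R = {(x, y). x \<in> carrier A \<and> (\<exists>ss css. malcev_chain \<Sigma> A X ss css x y)}"
  have car: "y \<in> carrier A" if "malcev_chain \<Sigma> A X ss css x y" for ss css x y
    using that by induction auto
  have rev: "\<exists>ss css. malcev_chain \<Sigma> A X ss css y x" if "malcev_chain \<Sigma> A X ss css x y" for ss css x y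
    using that
  proof induction
    case (Nil x)
    then show ?case by (blast intro: malcev_chain.Nil)
  next
    case (Cons n a b w cs ss css y)
    have "(a, b) \<in> set X" using Cons.hyps(1,2) by (metis nth_mem)
    then have "(b, a) \<in> set X" using X(2) by (rule symD[rotated])
    then show ?case
      using Cons.IH malcev_chain_single[OF A X(1) _ Cons.hyps(3)] malcev_chain_append by metis
  qed
  have "congruence \<Sigma> A R"
  proof (rule congruence_if_translations[OF A])
    show "equiv (carrier A) R"
    proof (rule equivI)
      show "R \<subseteq> carrier A \<times> carrier A" using car by (auto simp: R_def)
      show "refl_on (carrier A) R" by (auto simp: R_def refl_on_def intro: malcev_chain.Nil)
      show "sym R" using rev car by (fastforce simp: R_def sym_def)
      show "trans R" using malcev_chain_append by (fastforce simp: R_def trans_def)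
    qed
    show "(ops A f (c[k := x]), ops A f (c[k := y])) \<in> R"
      if f: "basic_translation \<Sigma> A (f, k) c" and xy: "(x, y) \<in> R" for f k c x y
      using xy malcev_chain_translate[OF A f] basic_translation_closed[OF A f] by (auto simp: R_def)
  qed
  moreover have "set X \<subseteq> R"
    using malcev_chain_single[OF A X(1), of _ _ "[]" "[]"] X(1) by (auto simp: R_def)
  ultimately have "cgen \<Sigma> A (set X) \<subseteq> R" by (rule cgen_least)
  then show ?thesis using xy by (auto simp: R_def)
qed

text \<open>The transitive closure of the union of two congruences is already a congruence, so their join
  connects elements by steps in one or the other.\<close>

lemma cgen_Un_subset_rtrancl:
  assumes A: "is_ualgebra \<Sigma> A" and \<theta>: "congruence \<Sigma> A \<theta>" and \<phi>: "congruence \<Sigma> A \<phi>"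
  shows "cgen \<Sigma> A (\<theta> \<union> \<phi>) \<subseteq> (\<theta> \<union> \<phi>)\<^sup>*"
proof -
  have sub: "\<theta> \<union> \<phi> \<subseteq> carrier A \<times> carrier A" 
    using congruence_carrier[OF \<theta>] congruence_carrier[OF \<phi>] by blast
  have s: "sym (\<theta> \<union> \<phi>)"
    using congruence_sym[OF \<theta>] congruence_sym[OF \<phi>] by (auto simp: sym_def)
  have "congruence \<Sigma> A ((\<theta> \<union> \<phi>)\<^sup>+)"
  proof (rule congruence_if_translations[OF A])
    show "equiv (carrier A) ((\<theta> \<union> \<phi>)\<^sup>+)"
    proof (rule equivI)
      show "(\<theta> \<union> \<phi>)\<^sup>+ \<subseteq> carrier A \<times> carrier A" by (rule trancl_subset_Sigma[OF sub])
      show "refl_on (carrier A) ((\<theta> \<union> \<phi>)\<^sup>+)" using congruence_refl[OF \<theta>] by (auto simp: refl_on_def)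
    qed (use s in \<open>simp_all add: sym_trancl\<close>)
    fix f k c x y
    assume f: "basic_translation \<Sigma> A (f, k) c"
    let ?p = "\<lambda>x. ops A f (c[k := x])"
    have step: "(?p x, ?p y) \<in> \<theta> \<union> \<phi>" if "(x, y) \<in> \<theta> \<union> \<phi>" for x y
      using that translate_cong_arg[OF \<theta>, of "[(f, k)]" "[c]"]
        translate_cong_arg[OF \<phi>, of "[(f, k)]" "[c]"] f by auto
    assume "(x, y) \<in> (\<theta> \<union> \<phi>)\<^sup>+"
    then show "(?p x, ?p y) \<in> (\<theta> \<union> \<phi>)\<^sup>+"
      by induction (use step in \<open>blast intro: trancl_into_trancl\<close>)+
  qed
  then have "cgen \<Sigma> A (\<theta> \<union> \<phi>) \<subseteq> (\<theta> \<union> \<phi>)\<^sup>+" by (rule cgen_least) auto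
  also have "\<dots> \<subseteq> (\<theta> \<union> \<phi>)\<^sup>*" by (auto intro: trancl_into_rtrancl)
  finally show ?thesis .
qed

lemma translate_hom:
  assumes A: "is_ualgebra \<Sigma> A" and h: "h \<in> ualg_hom \<Sigma> A B"
  shows "translation \<Sigma> A w cs \<Longrightarrow> x \<in> carrier A \<Longrightarrow>
    translation \<Sigma> B w (map (map h) cs) \<and> h (translate A w cs x) = translate B w (map (map h) cs) (h x)"
proof (induction w cs arbitrary: x rule: list_all2_induct)
  case (Cons fk w c cs)
  obtain f k where fk: "fk = (f, k)" by fastforce
  note f = Cons.hyps(1)[unfolded fk]
  have "set (c[k := x]) \<subseteq> carrier A"
    using f Cons.prems set_update_subset_insert[of c k x] by (auto simp: basic_translation_def)
  then have "h (ops A f (c[k := x])) = ops B f ((map h c)[k := h x])"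
    using h f by (auto simp: ualg_hom_def basic_translation_def map_update)
  moreover have "basic_translation \<Sigma> B (f, k) (map h c)"
    using h f by (auto simp: ualg_hom_def basic_translation_def)
  ultimately show ?case
    using Cons.IH[OF basic_translation_closed[OF A f Cons.prems]] by (simp add: fk)
qed simp

lemma malcev_chain_hom:
  assumes A: "is_ualgebra \<Sigma> A" and h: "h \<in> ualg_hom \<Sigma> A B" and X: "set X \<subseteq> carrier A \<times> carrier A"
  shows "malcev_chain \<Sigma> A X ss css x y \<Longrightarrow>
    malcev_chain \<Sigma> B (map (map_prod h h) X) ss (map (map (map h)) css) (h x) (h y)"
proof (induction rule: malcev_chain.induct)
  case (Nil x)
  then show ?case using h by (auto simp: ualg_hom_def intro: malcev_chain.Nil)
next
  case (Cons n a b w cs ss css y)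
  have "(a, b) \<in> set X" using Cons.hyps(1,2) by (metis nth_mem)
  then have "a \<in> carrier A" "b \<in> carrier A" using X by auto
  then show ?case
    using translate_hom[OF A h Cons.hyps(3)] Cons.hyps(1,2) Cons.IH
    by (auto intro: malcev_chain.Cons)
qed

text \<open>Two chains with the same scheme and \<open>\<delta>\<close>-related parameters stay \<open>\<delta>\<close>-related.  If they have the
  same start and each of their steps can be divided into smaller ones that lie in a congruence
  disjoint from \<open>\<delta>\<close>, then they cannot separate at any of these smaller steps.\<close>

lemma malcev_chain_unique:
  assumes \<delta>: "congruence \<Sigma> A \<delta>" and \<theta>: "congruence \<Sigma> A \<theta>" and \<phi>: "congruence \<Sigma> A \<phi>"
    and disj: "\<delta> \<inter> \<theta> \<subseteq> Id" "\<delta> \<inter> \<phi> \<subseteq> Id"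
    and X: "set X \<subseteq> (\<theta> \<union> \<phi>)\<^sup>*"
  shows "malcev_chain \<Sigma> A X ss css x y \<Longrightarrow> malcev_chain \<Sigma> A X ss css' x y' \<Longrightarrow>
    list_all2 (list_all2 (list_all2 (\<lambda>c c'. (c, c') \<in> \<delta>))) css css' \<Longrightarrow> y = y'"
proof (induction arbitrary: css' rule: malcev_chain.induct)
  case (Nil x)
  from Nil.prems(1) show ?case by cases auto
next
  case (Cons n a b w cs ss css y)
  from Cons.prems(1) obtain cs' ds where css': "css' = cs' # ds"
      and w': "translation \<Sigma> A w cs'"
      and start: "translate A w cs a = translate A w cs' a"
      and rest: "malcev_chain \<Sigma> A X ss ds (translate A w cs' b) y'"
    by cases (use Cons.hyps(2) in auto)
  have par: "list_all2 (list_all2 (\<lambda>c c'. (c, c') \<in> \<delta>)) cs cs'"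
    "list_all2 (list_all2 (list_all2 (\<lambda>c c'. (c, c') \<in> \<delta>))) css ds"
    using Cons.prems(2) by (simp_all add: css')
  have ab: "(a, b) \<in> set X" using Cons.hyps(1,2) by (metis nth_mem)
  \<comment> \<open>Agreement passes along a pair of \<open>\<psi>\<close>: the values at \<open>v\<close> are \<open>\<psi>\<close>-related through the common
    value at \<open>u\<close>, and \<open>\<delta>\<close>-related because the parameters are.\<close>
  have move: "translate A w cs v = translate A w cs' v"
    if eq: "translate A w cs u = translate A w cs' u" and uv: "(u, v) \<in> \<psi>"
      and \<psi>: "congruence \<Sigma> A \<psi>" "\<delta> \<inter> \<psi> \<subseteq> Id" for u v \<psi>
  proof -
    have "v \<in> carrier A" using congruence_carrier[OF \<psi>(1)] uv by blast
    then have "(translate A w cs v, translate A w cs' v) \<in> \<delta>"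
      using translate_cong[OF \<delta> Cons.hyps(3) w' par(1)] congruence_refl[OF \<delta>] by blast
    moreover have "(translate A w cs u, translate A w cs v) \<in> \<psi>"
      "(translate A w cs' u, translate A w cs' v) \<in> \<psi>"
      using translate_cong_arg[OF \<psi>(1) _ uv] Cons.hyps(3) w' by blast+
    then have "(translate A w cs v, translate A w cs' v) \<in> \<psi>"
      unfolding eq using congruence_trans[OF \<psi>(1)] congruence_sym[OF \<psi>(1)] by blast
    ultimately show ?thesis using \<psi>(2) by blast
  qed
  have "(a, b) \<in> (\<theta> \<union> \<phi>)\<^sup>*" using ab X by blast
  then have "translate A w cs b = translate A w cs' b"
  proof (induction rule: rtrancl_induct)
    case base
    show ?case by (rule start)
  next
    case (step u v)
    from step.hyps(2) show ?case
      using move[OF step.IH _ \<theta> disj(1)] move[OF step.IH _ \<phi> disj(2)] by blast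
  qed
  then show ?case by (intro Cons.IH[OF _ par(2)]) (simp only: rest)
qed

lemma malcev_chain_params:
  "malcev_chain \<Sigma> A X ss css x y \<Longrightarrow> set (concat (concat css)) \<subseteq> carrier A"
proof (induction rule: malcev_chain.induct)
  case (Cons n a b w cs ss css y)
  have "set c \<subseteq> carrier A" if "c \<in> set cs" for c
    using Cons.hyps(3) that
    by (fastforce simp: list_all2_conv_all_nth in_set_conv_nth basic_translation_def)
  then show ?case using Cons.IH by auto
qed simp

lemma malcev_chain_parallel:
  assumes "malcev_chain \<Sigma> A X ss css x y" "malcev_chain \<Sigma> A X ss css' x' y'"
    and "\<And>c c'. c \<in> set (concat (concat css)) \<Longrightarrow> c' \<in> set (concat (concat css')) \<Longrightarrow> T c c'"
  shows "list_all2 (list_all2 (list_all2 T)) css css'"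
  using assms
proof (induction arbitrary: css' x' rule: malcev_chain.induct)
  case (Nil x)
  from Nil.prems(1) show ?case by cases simp
next
  case (Cons n a b w cs ss css y)
  from Cons.prems(1) obtain cs' ds x'' where css': "css' = cs' # ds"
      and w': "translation \<Sigma> A w cs'" and rest: "malcev_chain \<Sigma> A X ss ds x'' y'"
    by cases auto
  have "list_all2 (list_all2 (list_all2 T)) css ds"
    using Cons.prems(2) by (intro Cons.IH[OF rest]) (auto simp: css')
  moreover have "list_all2 (list_all2 T) cs cs'"
  proof (rule list_all2_all_nthI)
    show "length cs = length cs'" using Cons.hyps(3) w' by (metis list_all2_lengthD)
    fix k assume k: "k < length cs"
    have "k < length w" "k < length cs'"
      using k list_all2_lengthD[OF Cons.hyps(3)] list_all2_lengthD[OF w'] by simp_all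
    then have "basic_translation \<Sigma> A (w ! k) (cs ! k)" "basic_translation \<Sigma> A (w ! k) (cs' ! k)"
      using list_all2_nthD[OF Cons.hyps(3)] list_all2_nthD[OF w'] by blast+
    then have len: "length (cs ! k) = length (cs' ! k)"
      by (auto simp: basic_translation_def split: prod.splits)
    have mem: "cs ! k \<in> set cs" "cs' ! k \<in> set cs'" using k \<open>k < length cs'\<close> by simp_all
    show "list_all2 T (cs ! k) (cs' ! k)"
    proof (rule list_all2_all_nthI[OF len])
      fix l assume "l < length (cs ! k)"
      then have "cs ! k ! l \<in> set (cs ! k)" "cs' ! k ! l \<in> set (cs' ! k)" using len by simp_all
      then show "T (cs ! k ! l) (cs' ! k ! l)"
        using mem by (intro Cons.prems(2)) (auto simp: css')
    qed
  qed
  ultimately show ?case by (simp add: css')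
qed

lemma list_all2_map_both:
  "list_all2 T (map f xs) (map f ys) \<longleftrightarrow> list_all2 (\<lambda>x y. T (f x) (f y)) xs ys"
  by (simp add: list.rel_map)

lemma congruence_Id_on:
  assumes "is_ualgebra \<Sigma> A" shows "congruence \<Sigma> A (Id_on (carrier A))"
proof (rule congruence_if_translations[OF assms])
  show "equiv (carrier A) (Id_on (carrier A))"
    by (auto simp: equiv_def refl_on_def sym_def trans_def)
qed (auto simp: basic_translation_closed[OF assms])

lemma cgen_mono: "X \<subseteq> Y \<Longrightarrow> cgen \<Sigma> A X \<subseteq> cgen \<Sigma> A Y"
  by (auto simp: cgen_def)


section \<open>A semilattice that is a directed union of finite simple lattices\<close>

text \<open>The Boolean arguments distinguish the two near and the two far atoms of an index.  Two near atoms
  per index are needed to generate \<open>Span {}\<close> even when only one index is available; two far atoms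
  with the same support make a collapse of near atoms spread to far ones.\<close>

datatype 'i flat = Bot | Near 'i bool | Far 'i bool | Span "'i set"

primrec support :: "'i flat \<Rightarrow> 'i set" where
  "support Bot = {}"
| "support (Near i t) = {}"
| "support (Far i t) = {i}"
| "support (Span N) = N"

definition flat_le :: "'i flat \<Rightarrow> 'i flat \<Rightarrow> bool" where
  "flat_le x y \<longleftrightarrow> x = Bot \<or> x = y \<or> (\<exists>N. y = Span N \<and> support x \<subseteq> N)"

definition flat_join :: "'i flat \<Rightarrow> 'i flat \<Rightarrow> 'i flat" where
  "flat_join x y =
    (if flat_le x y then y else if flat_le y x then x else Span (support x \<union> support y))"

primrec is_Span :: "'i flat \<Rightarrow> bool" where
  "is_Span Bot = False"
| "is_Span (Near i t) = False"
| "is_Span (Far i t) = False"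
| "is_Span (Span N) = True"

definition flat_meet :: "'i flat \<Rightarrow> 'i flat \<Rightarrow> 'i flat" where
  "flat_meet x y =
    (if flat_le x y then x else if flat_le y x then y
     else if is_Span x \<and> is_Span y then Span (support x \<inter> support y) else Bot)"

definition flats :: "'i set \<Rightarrow> 'i flat set" where
  "flats P = {Bot} \<union> (\<lambda>(i, t). Near i t) ` (P \<times> UNIV) \<union> (\<lambda>(i, t). Far i t) ` (P \<times> UNIV) \<union> Span ` Pow P"

lemma flats_simps [simp]:
  "Bot \<in> flats P" "Near i t \<in> flats P \<longleftrightarrow> i \<in> P" "Far i t \<in> flats P \<longleftrightarrow> i \<in> P"
  "Span N \<in> flats P \<longleftrightarrow> N \<subseteq> P"
  by (auto simp: flats_def)

lemma finite_flats: "finite P \<Longrightarrow> finite (flats P)"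
  by (simp add: flats_def)

lemma flats_mono: "P \<subseteq> Q \<Longrightarrow> flats P \<subseteq> flats Q"
  by (auto simp: flats_def)

lemma support_flats: "x \<in> flats P \<Longrightarrow> support x \<subseteq> P"
  by (cases x) auto

lemma flat_le_simps [simp]:
  "flat_le x Bot \<longleftrightarrow> x = Bot" "flat_le x (Near i t) \<longleftrightarrow> x = Bot \<or> x = Near i t"
  "flat_le x (Far i t) \<longleftrightarrow> x = Bot \<or> x = Far i t" "flat_le x (Span N) \<longleftrightarrow> support x \<subseteq> N"
  by (auto simp: flat_le_def)

lemma flat_le_refl [simp]: "flat_le x x"
  by (simp add: flat_le_def)

lemma flat_le_Bot [simp]: "flat_le Bot x"
  by (simp add: flat_le_def)

lemma flat_le_support: "flat_le x y \<Longrightarrow> support x \<subseteq> support y"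
  by (cases y) auto

lemma flat_le_trans: "flat_le x y \<Longrightarrow> flat_le y z \<Longrightarrow> flat_le x z"
  using flat_le_support[of x y] by (cases z) auto

lemma flat_le_antisym: "flat_le x y \<Longrightarrow> flat_le y x \<Longrightarrow> x = y"
  by (cases y; cases x) simp_all

lemma flat_join_closed: "x \<in> flats P \<Longrightarrow> y \<in> flats P \<Longrightarrow> flat_join x y \<in> flats P"
  using support_flats[of x P] support_flats[of y P] by (auto simp: flat_join_def)

lemma flat_meet_closed: "x \<in> flats P \<Longrightarrow> y \<in> flats P \<Longrightarrow> flat_meet x y \<in> flats P"
  using support_flats[of x P] by (auto simp: flat_meet_def)

lemma flat_join_upper: "flat_le x (flat_join x y)" "flat_le y (flat_join x y)"
  by (simp_all add: flat_join_def)

lemma flat_join_least: "flat_le x z \<Longrightarrow> flat_le y z \<Longrightarrow> flat_le (flat_join x y) z"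
  by (cases z) (auto simp: flat_join_def)

lemma flat_meet_lower: "flat_le (flat_meet x y) x" "flat_le (flat_meet x y) y"
  by (cases x; cases y; simp add: flat_meet_def)+

lemma flat_meet_greatest:
  assumes "flat_le z x" "flat_le z y" shows "flat_le z (flat_meet x y)"
proof (cases "is_Span x \<and> is_Span y")
  case True
  then show ?thesis using assms by (cases x; cases y) (simp_all add: flat_meet_def)
next
  case False
  then show ?thesis using assms by (cases x; cases y) (auto simp: flat_meet_def)
qed

text \<open>Every element of a set \<open>flats P\<close> with \<open>P\<close> finite mentions only finitely many indices, so in an
  infinite supply of indices there are always far atoms disjoint from it.\<close>

lemma far_disjoint:
  assumes "n \<notin> support x" "flat_le y x" "flat_le y (Far n t)"
  shows "y = Bot"
  using assms flat_le_support[of y x] by auto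

lemma near_disjoint: "i \<noteq> j \<Longrightarrow> flat_le y (Near i t) \<Longrightarrow> flat_le y (Near j u) \<Longrightarrow> y = Bot"
  by auto


subsection \<open>Order-isomorphic copies\<close>

text \<open>The same computation of joins, meets and bottom is needed twice, for the lattice of codes in
  \<open>nat\<close> and for its one-factor product.\<close>

locale flats_copy =
  fixes P :: "'i set" and L :: "'a gorder" (structure) and h :: "'i flat \<Rightarrow> 'a"
  assumes bij: "bij_betw h (flats P) (carrier L)"
    and eq_L: "eq L = (=)"
    and le_L: "x \<in> flats P \<Longrightarrow> y \<in> flats P \<Longrightarrow> le L (h x) (h y) \<longleftrightarrow> flat_le x y"
begin

lemma h_closed: "x \<in> flats P \<Longrightarrow> h x \<in> carrier L"
  using bij by (auto simp: bij_betw_def)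

lemma h_inj: "x \<in> flats P \<Longrightarrow> y \<in> flats P \<Longrightarrow> h x = h y \<longleftrightarrow> x = y"
  using bij by (auto simp: bij_betw_def inj_on_def)

lemma carrier_flat: "u \<in> carrier L \<Longrightarrow> (\<And>x. x \<in> flats P \<Longrightarrow> u = h x \<Longrightarrow> thesis) \<Longrightarrow> thesis"
  using bij by (auto simp: bij_betw_def)

sublocale partial_order L
proof unfold_locales
  fix u v w
  assume u: "u \<in> carrier L" and v: "v \<in> carrier L" and w: "w \<in> carrier L"
  obtain x where x: "x \<in> flats P" "u = h x" using u by (rule carrier_flat)
  obtain y where y: "y \<in> flats P" "v = h y" using v by (rule carrier_flat)
  obtain z where z: "z \<in> flats P" "w = h z" using w by (rule carrier_flat)
  show "u \<sqsubseteq> w" if "u \<sqsubseteq> v" "v \<sqsubseteq> w"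
    using that flat_le_trans[of x y z] by (simp add: x y z le_L)
next
  fix u v
  assume u: "u \<in> carrier L" and v: "v \<in> carrier L" and uv: "u \<sqsubseteq> v" "v \<sqsubseteq> u"
  obtain x where x: "x \<in> flats P" "u = h x" using u by (rule carrier_flat)
  obtain y where y: "y \<in> flats P" "v = h y" using v by (rule carrier_flat)
  show "u .= v"
    using uv flat_le_antisym[of x y] by (simp add: x y le_L eq_L)
next
  fix u assume "u \<in> carrier L"
  then obtain x where "x \<in> flats P" "u = h x" by (rule carrier_flat)
  then show "u \<sqsubseteq> u" by (simp add: le_L)
qed (simp_all add: eq_L)

lemma least_join:
  assumes x: "x \<in> flats P" and y: "y \<in> flats P"
  shows "least L (h (flat_join x y)) (Upper L {h x, h y})"
proof -
  note j = flat_join_closed[OF x y]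
  have "h (flat_join x y) \<sqsubseteq> u" if u: "u \<in> carrier L" "h x \<sqsubseteq> u" "h y \<sqsubseteq> u" for u
  proof -
    obtain z where z: "z \<in> flats P" "u = h z" using u(1) by (rule carrier_flat)
    then have "flat_le (flat_join x y) z"
      using u(2,3) x y by (simp add: le_L flat_join_least)
    then show ?thesis using z j by (simp add: le_L)
  qed
  moreover have "h x \<sqsubseteq> h (flat_join x y)" "h y \<sqsubseteq> h (flat_join x y)"
    using x y j by (simp_all add: le_L flat_join_upper)
  ultimately show ?thesis
    using h_closed[OF x] h_closed[OF y] h_closed[OF j] unfolding least_def Upper_def by simp
qed

lemma greatest_meet:
  assumes x: "x \<in> flats P" and y: "y \<in> flats P"
  shows "greatest L (h (flat_meet x y)) (Lower L {h x, h y})"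
proof -
  note m = flat_meet_closed[OF x y]
  have "u \<sqsubseteq> h (flat_meet x y)" if u: "u \<in> carrier L" "u \<sqsubseteq> h x" "u \<sqsubseteq> h y" for u
  proof -
    obtain z where z: "z \<in> flats P" "u = h z" using u(1) by (rule carrier_flat)
    then have "flat_le z (flat_meet x y)"
      using u(2,3) x y by (simp add: le_L flat_meet_greatest)
    then show ?thesis using z m by (simp add: le_L)
  qed
  moreover have "h (flat_meet x y) \<sqsubseteq> h x" "h (flat_meet x y) \<sqsubseteq> h y"
    using x y m by (simp_all add: le_L flat_meet_lower)
  ultimately show ?thesis
    using h_closed[OF x] h_closed[OF y] h_closed[OF m] unfolding greatest_def Lower_def by simp
qed

sublocale lattice L
proof unfold_locales
  fix u v assume u: "u \<in> carrier L" and v: "v \<in> carrier L"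
  obtain x where x: "x \<in> flats P" "u = h x" using u by (rule carrier_flat)
  obtain y where y: "y \<in> flats P" "v = h y" using v by (rule carrier_flat)
  show "\<exists>s. least L s (Upper L {u, v})"
    unfolding x(2) y(2) using least_join[OF x(1) y(1)] by (rule exI)
  show "\<exists>s. greatest L s (Lower L {u, v})"
    unfolding x(2) y(2) using greatest_meet[OF x(1) y(1)] by (rule exI)
qed

lemma least_Bot: "least L (h Bot) (carrier L)"
proof -
  have "h Bot \<sqsubseteq> u" if "u \<in> carrier L" for u
    using that by (rule carrier_flat) (simp add: le_L)
  then show ?thesis by (simp add: least_def h_closed)
qed

lemma join_eq:
  assumes "x \<in> flats P" "y \<in> flats P" shows "h x \<squnion> h y = h (flat_join x y)"
  unfolding join_def sup_def
  using least_join[OF assms] least_unique[OF _ least_join[OF assms]] by (rule some_equality)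

lemma meet_eq:
  assumes "x \<in> flats P" "y \<in> flats P" shows "h x \<sqinter> h y = h (flat_meet x y)"
  unfolding meet_def inf_def
  using greatest_meet[OF assms] greatest_unique[OF _ greatest_meet[OF assms]] by (rule some_equality)

lemma bottom_eq: "\<bottom> = h Bot"
  unfolding bottom_def using least_Bot least_unique[OF _ least_Bot] by (rule some_equality)

lemma join_zero_semilattice: "join_zero_semilattice L"
  by unfold_locales (rule exI, rule least_Bot)

end

subsection \<open>Simplicity\<close>

text \<open>If \<open>a < b\<close> are identified, then so are \<open>Bot\<close> and any atom that is below \<open>b\<close> but not below \<open>a\<close>.  A collapsed
  atom collapses another atom \<open>p\<close> whenever it joins with some \<open>q\<close> disjoint from \<open>p\<close> to an element above
  \<open>p\<close>.  Taking for \<open>q\<close> the second far atom of an index, one gets from near atoms to all far atoms and back.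
  Finally \<open>Span P\<close> is a join of atoms.\<close>

lemma flat_congruence_trivial:
  assumes eqv: "\<And>x. x \<in> flats P \<Longrightarrow> R x x"
    "\<And>x y. R x y \<Longrightarrow> R y x" "\<And>x y z. R x y \<Longrightarrow> R y z \<Longrightarrow> R x z"
    and join: "\<And>x y z. R x y \<Longrightarrow> z \<in> flats P \<Longrightarrow> R (flat_join x z) (flat_join y z)"
    and meet: "\<And>x y z. R x y \<Longrightarrow> z \<in> flats P \<Longrightarrow> R (flat_meet x z) (flat_meet y z)"
    and P: "finite P" and xy: "x \<in> flats P" "y \<in> flats P" "R x y" "x \<noteq> y"
    and uv: "u \<in> flats P" "v \<in> flats P"
  shows "R u v"
proof -
  have "R Bot (Span P)"
  \<comment> \<open>Without indices there are no atoms: \<open>flats {}\<close> is the chain \<open>Bot < Span {}\<close>.\<close>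
  proof (cases "P = {}")
    case True
    then have "x = Bot \<and> y = Span P \<or> x = Span P \<and> y = Bot"
      using xy by (auto simp: flats_def)
    then show ?thesis using xy(3) eqv(2) by auto
  next
    case False
    then obtain i where i: "i \<in> P" by blast
    define a where "a = flat_meet x y"
    define b where "b = flat_join x y"
    have ab: "a \<in> flats P" "b \<in> flats P" "R a b" "a \<noteq> b" "flat_le a b"
    proof -
      show "a \<in> flats P" "b \<in> flats P" using xy by (simp_all add: a_def b_def flat_meet_closed flat_join_closed)
      have "R a y" using meet[OF xy(3,2)] by (simp add: a_def flat_meet_def)
      moreover have "R b y" using join[OF xy(3,2)] by (simp add: b_def flat_join_def)
      ultimately show "R a b" using eqv(2,3) by blast
      show "a \<noteq> b" "flat_le a b" using xy flat_meet_lower flat_join_upper flat_le_trans flat_le_antisym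
        unfolding a_def b_def by metis+
    qed
    obtain c where c: "c \<in> flats P" "\<not> is_Span c" "c \<noteq> Bot" "flat_le c b" "\<not> flat_le c a"
    proof (cases "is_Span b")
      case False
      then have "b \<noteq> Bot \<and> \<not> flat_le b a"
        using ab(4,5) flat_le_antisym by (auto simp: flat_le_def)
      then show ?thesis using that[of b] ab(2) False by simp
    next
      case True
      then obtain N where N: "b = Span N" by (cases b) auto
      show ?thesis
      proof (cases a)
        case Bot
        then show ?thesis using that[of "Near i True"] i N by (simp add: flat_le_def)
      next
        case (Near j t)
        then show ?thesis using that[of "Near j (\<not> t)"] ab(1) N by (simp add: flat_le_def)
      next
        case (Far j t)
        then show ?thesis using that[of "Near i True"] i N by (simp add: flat_le_def)
      next
        case (Span M)
        then obtain n where "n \<in> N" "n \<notin> M" using ab(4,5) N by (auto simp: flat_le_def)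
        then show ?thesis using that[of "Far n True"] ab(2) N Span by (auto simp: flat_le_def)
      qed
    qed
    have "R (flat_meet a c) (flat_meet b c)" using meet ab(3) c(1) .
    moreover have "flat_meet a c = Bot"
      using c by (cases c) (auto simp: flat_meet_def)
    moreover have "flat_meet b c = c"
      using c flat_le_antisym[of b c] by (auto simp: flat_meet_def)
    ultimately have Bc: "R Bot c" by simp
    have near_far: "R Bot (Far n t)" if j: "j \<in> P" "R Bot (Near j s)" and n: "n \<in> P" for j s n t
    proof -
      have "R (flat_join Bot (Far n (\<not> t))) (flat_join (Near j s) (Far n (\<not> t)))"
        using j(2) n by (intro join) auto
      then have "R (Far n (\<not> t)) (Span {n})" by (simp add: flat_join_def)
      then have "R (flat_meet (Far n (\<not> t)) (Far n t)) (flat_meet (Span {n}) (Far n t))"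
        using n by (intro meet) auto
      then show ?thesis by (simp add: flat_meet_def)
    qed
    have far_near: "R Bot (Near i t)" if n: "n \<in> P" "R Bot (Far n s)" for n s t
    proof -
      have "R (flat_join Bot (Far n (\<not> s))) (flat_join (Far n s) (Far n (\<not> s)))"
        using n by (intro join) auto
      then have "R (Far n (\<not> s)) (Span {n})" by (simp add: flat_join_def)
      then have "R (flat_meet (Far n (\<not> s)) (Near i t)) (flat_meet (Span {n}) (Near i t))"
        using i by (intro meet) auto
      then show ?thesis by (simp add: flat_meet_def)
    qed
    have far: "R Bot (Far n t)" if "n \<in> P" for n t
    proof (cases c)
      case (Near j s)
      then show ?thesis using near_far[OF _ _ that] Bc c(1) by simp
    next
      case (Far m s)
      then have "R Bot (Near i True)" using far_near[of m s] Bc c(1) by simp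
      then show ?thesis by (rule near_far[OF i _ that])
    qed (use c in simp_all)
    have near: "R Bot (Near i t)" for t
      by (rule far_near[OF i far[OF i]])
    have "R Bot (Span N)" if "finite N" "N \<subseteq> P" for N
      using that
    proof (induction N)
      case empty
      have "R (flat_join Bot (Near i False)) (flat_join (Near i True) (Near i False))"
        using near i by (intro join) auto
      then have "R (Near i False) (Span {})" by (simp add: flat_join_def)
      then show ?case using near eqv(3) by blast
    next
      case (insert n N)
      have "R (flat_join Bot (Far n True)) (flat_join (Span N) (Far n True))"
        using insert by (intro join) auto
      then have "R (Far n True) (Span (insert n N))"
        using insert.hyps by (simp add: flat_join_def)
      then show ?case using far[of n True] insert.prems eqv(3) by blast
    qed
    then show ?thesis using P by blast
  qed
  then have "R Bot z" if z: "z \<in> flats P" for z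
  proof -
    have "flat_le z (Span P)" using support_flats[OF z] by simp
    then have "flat_meet (Span P) z = z" using flat_le_antisym[of "Span P" z] by (auto simp: flat_meet_def)
    moreover have "R (flat_meet Bot z) (flat_meet (Span P) z)"
      using \<open>R Bot (Span P)\<close> z by (rule meet)
    ultimately show ?thesis by (simp add: flat_meet_def)
  qed
  then show ?thesis using uv eqv(2,3) by blast
qed


lemma flats_copy_simple:
  assumes L: "flats_copy P L h" and P: "finite P"
  shows "finite_simple_lattice L"
proof -
  interpret flats_copy P L h by (rule L)
  have "\<theta> = carrier L \<times> carrier L" if \<theta>: "lattice_congruence L \<theta>" and ne: "\<theta> \<noteq> Id_on (carrier L)" for \<theta>
  proof -
    have eqv: "equiv (carrier L) \<theta>" using \<theta> by (simp add: lattice_congruence_def)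
    then have sub: "\<theta> \<subseteq> carrier L \<times> carrier L" and rfl: "Id_on (carrier L) \<subseteq> \<theta>"
      by (auto simp: equiv_def refl_on_def)
    define R where "R x y \<longleftrightarrow> x \<in> flats P \<and> y \<in> flats P \<and> (h x, h y) \<in> \<theta>" for x y
    obtain p q where "(p, q) \<in> \<theta>" "p \<noteq> q" using ne rfl sub by fast
    moreover from this have "p \<in> carrier L" "q \<in> carrier L" using sub by auto
    ultimately obtain x y where xy: "x \<in> flats P" "y \<in> flats P" "R x y" "x \<noteq> y"
      by (auto simp: R_def elim!: carrier_flat)
    have compat: "R (flat_join x z) (flat_join y z)" "R (flat_meet x z) (flat_meet y z)"
      if xy: "R x y" and z: "z \<in> flats P" for x y z
    proof -
      have "(h z, h z) \<in> \<theta>" using rfl h_closed[OF z] by blast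
      then have "(h x \<squnion>\<^bsub>L\<^esub> h z, h y \<squnion>\<^bsub>L\<^esub> h z) \<in> \<theta>"
        "(h x \<sqinter>\<^bsub>L\<^esub> h z, h y \<sqinter>\<^bsub>L\<^esub> h z) \<in> \<theta>"
        using \<theta> xy unfolding lattice_congruence_def R_def by blast+
      then show "R (flat_join x z) (flat_join y z)" "R (flat_meet x z) (flat_meet y z)"
        using xy z by (simp_all add: R_def join_eq meet_eq flat_join_closed flat_meet_closed)
    qed
    have "R x x" if "x \<in> flats P" for x using that rfl h_closed by (auto simp: R_def)
    moreover have "R y x" if "R x y" for x y using that eqv by (auto simp: R_def equiv_def sym_def)
    moreover have "R x z" if "R x y" "R y z" for x y z
      using that eqv by (auto simp: R_def equiv_def trans_def)
    ultimately have "R u v" if "u \<in> flats P" "v \<in> flats P" for u v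
      by (rule flat_congruence_trivial[of P R, OF _ _ _ compat P xy that])
    then show ?thesis using sub by (auto simp: R_def elim!: carrier_flat)
  qed
  moreover have "finite (carrier L)" using bij finite_flats[OF P] bij_betw_finite by blast
  moreover have "carrier L \<noteq> {}" using h_closed[of Bot] by auto
  ultimately show ?thesis
    unfolding finite_simple_lattice_def using lattice_axioms by blast
qed

lemma flats_inclusion_slat_hom:
  assumes "flats_copy P L h" "flats_copy Q M k" and PQ: "P \<subseteq> Q"
    and d: "\<And>x. x \<in> flats P \<Longrightarrow> d (h x) = k x"
  shows "d \<in> slat_hom L M" "inj_on d (carrier L)"
proof -
  interpret L: flats_copy P L h by (rule assms)
  interpret M: flats_copy Q M k by (rule assms)
  note sub = subsetD[OF flats_mono[OF PQ]]
  have "d (h x \<squnion>\<^bsub>L\<^esub> h y) = d (h x) \<squnion>\<^bsub>M\<^esub> d (h y)" if "x \<in> flats P" "y \<in> flats P" for x y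
    using that by (simp add: L.join_eq M.join_eq d flat_join_closed sub)
  then show "d \<in> slat_hom L M"
    unfolding slat_hom_def
    by (auto simp: d L.bottom_eq M.bottom_eq M.h_closed sub elim!: L.carrier_flat)
  show "inj_on d (carrier L)"
    by (rule inj_onI, elim L.carrier_flat) (auto simp: d M.h_inj sub)
qed

subsection \<open>The diagram\<close>

text \<open>No injection of all elements into \<open>nat\<close> exists, so each finite piece gets a coding of its own, and
  the inclusions become recodings.\<close>

definition flat_code :: "'i set \<Rightarrow> 'i flat \<Rightarrow> nat" where
  "flat_code P = (SOME g. inj_on g (flats P))"

lemma inj_flat_code: "finite P \<Longrightarrow> inj_on (flat_code P) (flats P)"
  unfolding flat_code_def
  using finite_imp_inj_to_nat_seg[OF finite_flats, of P] by (metis someI_ex)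

definition flat_lattice :: "'i set \<Rightarrow> nat gorder" where
  "flat_lattice P = \<lparr> carrier = flat_code P ` flats P, eq = (=),
     le = (\<lambda>u v. flat_le (inv_into (flats P) (flat_code P) u) (inv_into (flats P) (flat_code P) v)) \<rparr>"

definition flat_object :: "'i set \<Rightarrow> (nat \<Rightarrow> nat) gorder" where
  "flat_object P = product_order 1 (\<lambda>_. flat_lattice P)"

definition flat_point :: "'i set \<Rightarrow> 'i flat \<Rightarrow> nat \<Rightarrow> nat" where
  "flat_point P x = (\<lambda>k\<in>{..<1}. flat_code P x)"

definition flat_arrow :: "'i set \<Rightarrow> 'i set \<Rightarrow> (nat \<Rightarrow> nat) \<Rightarrow> nat \<Rightarrow> nat" where
  "flat_arrow P Q u = flat_point Q (inv_into (flats P) (flat_point P) u)"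

lemma flats_copy_lattice: "finite P \<Longrightarrow> flats_copy P (flat_lattice P) (flat_code P)"
  by unfold_locales (auto simp: flat_lattice_def bij_betw_def inj_flat_code)

lemma flats_copy_object:
  assumes P: "finite P" shows "flats_copy P (flat_object P) (flat_point P)"
proof -
  have inj: "inj_on (flat_point P) (flats P)"
  proof (rule inj_onI)
    fix x y assume xy: "x \<in> flats P" "y \<in> flats P" "flat_point P x = flat_point P y"
    then have "flat_point P x 0 = flat_point P y 0" by simp
    then show "x = y" using xy inj_onD[OF inj_flat_code[OF P]] by (simp add: flat_point_def)
  qed
  have "(\<Pi>\<^sub>E k\<in>{..<1}. flat_code P ` flats P) = flat_point P ` flats P"
  proof (intro equalityI subsetI)
    fix f :: "nat \<Rightarrow> nat" assume f: "f \<in> (\<Pi>\<^sub>E k\<in>{..<1}. flat_code P ` flats P)"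
    then have "f 0 \<in> flat_code P ` flats P" by (rule PiE_mem) simp
    then obtain x where x: "x \<in> flats P" "f 0 = flat_code P x" by blast
    have "f k = flat_point P x k" for k
      using x(2) PiE_arb[OF f, of k] by (cases "k = 0") (simp_all add: flat_point_def)
    then show "f \<in> flat_point P ` flats P" using x(1) by blast
  next
    fix f :: "nat \<Rightarrow> nat" assume "f \<in> flat_point P ` flats P"
    then obtain x where "x \<in> flats P" "f = flat_point P x" by blast
    then show "f \<in> (\<Pi>\<^sub>E k\<in>{..<1}. flat_code P ` flats P)"
      by (simp only: flat_point_def restrict_PiE_iff) blast
  qed
  then have car: "carrier (flat_object P) = flat_point P ` flats P"
    by (simp add: flat_object_def product_order_def flat_lattice_def)
  show ?thesis
  proof
    show "bij_betw (flat_point P) (flats P) (carrier (flat_object P))"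
      using inj car by (simp add: bij_betw_def)
    show "eq (flat_object P) = (=)" by (simp add: flat_object_def product_order_def)
    show "flat_point P x \<sqsubseteq>\<^bsub>flat_object P\<^esub> flat_point P y \<longleftrightarrow> flat_le x y"
      if "x \<in> flats P" "y \<in> flats P" for x y
      using that inj_flat_code[OF P]
      by (simp add: flat_object_def product_order_def flat_lattice_def flat_point_def)
  qed
qed

lemma flat_arrow_point:
  assumes "finite P" "x \<in> flats P" shows "flat_arrow P Q (flat_point P x) = flat_point Q x"
proof -
  interpret flats_copy P "flat_object P" "flat_point P" by (rule flats_copy_object[OF assms(1)])
  show ?thesis using bij assms(2) by (simp add: flat_arrow_def bij_betw_def)
qed

definition finite_subsets :: "'i set gorder" where
  "finite_subsets = \<lparr> carrier = {P. finite P}, eq = (=), le = (\<subseteq>) \<rparr>"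

lemma distributive_lattice_finite_subsets: "distributive_lattice (finite_subsets :: 'i set gorder)"
proof -
  let ?I = "finite_subsets :: 'i set gorder"
  interpret partial_order ?I by unfold_locales (auto simp: finite_subsets_def)
  have lub: "least ?I (x \<union> y) (Upper ?I {x, y})" if "finite x" "finite y" for x y :: "'i set"
    using that by (auto simp: least_def Upper_def finite_subsets_def)
  have glb: "greatest ?I (x \<inter> y) (Lower ?I {x, y})" if "finite x" "finite y" for x y :: "'i set"
    using that by (auto simp: greatest_def Lower_def finite_subsets_def)
  interpret lattice ?I
  proof
    fix x y :: "'i set" assume "x \<in> carrier ?I" "y \<in> carrier ?I"
    then have xy: "finite x" "finite y" by (simp_all add: finite_subsets_def)
    show "\<exists>s. least ?I s (Upper ?I {x, y})" using lub[OF xy] by (rule exI)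
    show "\<exists>s. greatest ?I s (Lower ?I {x, y})" using glb[OF xy] by (rule exI)
  qed
  have join: "x \<squnion>\<^bsub>?I\<^esub> y = x \<union> y" if "finite x" "finite y" for x y :: "'i set"
    unfolding join_def sup_def
    using lub[OF that] least_unique[OF _ lub[OF that]] by (rule some_equality)
  have meet: "x \<sqinter>\<^bsub>?I\<^esub> y = x \<inter> y" if "finite x" "finite y" for x y :: "'i set"
    unfolding meet_def inf_def
    using glb[OF that] greatest_unique[OF _ glb[OF that]] by (rule some_equality)
  show ?thesis
  proof
    fix x y z :: "'i set" assume "x \<in> carrier ?I" "y \<in> carrier ?I" "z \<in> carrier ?I"
    then have "finite x" "finite y" "finite z" by (simp_all add: finite_subsets_def)
    then show "x \<sqinter>\<^bsub>?I\<^esub> (y \<squnion>\<^bsub>?I\<^esub> z) = (x \<sqinter>\<^bsub>?I\<^esub> y) \<squnion>\<^bsub>?I\<^esub> (x \<sqinter>\<^bsub>?I\<^esub> z)"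
      by (simp add: join meet Int_Un_distrib)
  qed
qed

lemma slat_diagram_flats: "slat_diagram finite_subsets flat_object flat_arrow"
  unfolding poset_functor_def
proof (intro conjI ballI allI impI)
  fix P Q :: "'a set"
  assume "P \<in> carrier finite_subsets" "Q \<in> carrier finite_subsets" "P \<sqsubseteq>\<^bsub>finite_subsets\<^esub> Q"
  then show "flat_arrow P Q \<in> slat_hom (flat_object P) (flat_object Q)"
    by (intro flats_inclusion_slat_hom(1)[OF flats_copy_object flats_copy_object])
       (auto simp: finite_subsets_def flat_arrow_point)
next
  fix P :: "'a set" assume "P \<in> carrier finite_subsets"
  then have P: "finite P" by (simp add: finite_subsets_def)
  interpret flats_copy P "flat_object P" "flat_point P" by (rule flats_copy_object[OF P])
  show "join_zero_semilattice (flat_object P)" by (rule join_zero_semilattice)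
  show "flat_arrow P P u = u" if "u \<in> carrier (flat_object P)" for u
    using that P by (auto simp: flat_arrow_point elim!: carrier_flat)
next
  fix P Q R :: "'a set" and u
  assume "P \<in> carrier finite_subsets" "Q \<in> carrier finite_subsets"
    and PQ: "P \<sqsubseteq>\<^bsub>finite_subsets\<^esub> Q \<and> Q \<sqsubseteq>\<^bsub>finite_subsets\<^esub> R" and u: "u \<in> carrier (flat_object P)"
  then have P: "finite P" "finite Q" by (simp_all add: finite_subsets_def)
  interpret flats_copy P "flat_object P" "flat_point P" by (rule flats_copy_object[OF P(1)])
  show "flat_arrow Q R (flat_arrow P Q u) = flat_arrow P R u"
    using u P PQ flats_mono[of P Q]
    by (auto simp: flat_arrow_point finite_subsets_def elim!: carrier_flat)
qed


section \<open>Counting\<close>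

lemma ex_inj_pair:
  assumes g: "inj (g :: 'a \<Rightarrow> 'c)" and h: "inj (h :: 'b \<Rightarrow> 'c)" and inf: "infinite (UNIV :: 'c set)"
  shows "\<exists>p :: 'a \<times> 'b \<Rightarrow> 'c. inj p"
proof -
  obtain p :: "'c \<times> 'c \<Rightarrow> 'c" where "bij_betw p (UNIV \<times> UNIV) UNIV"
    using card_of_Times_same_infinite[OF inf] card_of_ordIso by blast
  then have "inj p" by (simp add: bij_betw_def)
  then have "inj (p \<circ> map_prod g h)"
    using g h by (intro inj_compose prod.inj_map)
  then show ?thesis by blast
qed

text \<open>Lists are coded by iterating an injection \<open>p\<close> of pairs.  The bijection \<open>u\<close> onto the complement of
  a point \<open>a\<close> keeps the value \<open>a\<close> free for the empty list.\<close>

lemma ex_inj_list: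
  assumes g: "inj (g :: 'a \<Rightarrow> 'c)" and inf: "infinite (UNIV :: 'c set)"
  shows "\<exists>h :: 'a list \<Rightarrow> 'c. inj h"
proof -
  obtain p :: "'a \<times> 'c \<Rightarrow> 'c" where p: "inj p" using ex_inj_pair[OF g inj_on_id inf] by blast
  obtain u :: "'c \<Rightarrow> 'c" and a where u: "bij_betw u UNIV (UNIV - {a})"
    using infinite_imp_bij_betw[OF inf] by blast
  define h where "h = rec_list a (\<lambda>x _ c. u (p (x, c)))"
  have h: "h [] = a" "h (x # xs) = u (p (x, h xs))" for x xs by (simp_all add: h_def)
  have ua: "u c \<noteq> a" for c using u by (auto simp: bij_betw_def)
  have uu: "u c = u c' \<longleftrightarrow> c = c'" for c c' using u by (auto simp: bij_betw_def inj_on_def)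
  have "h xs = h ys \<Longrightarrow> xs = ys" for xs ys
  proof (induction xs arbitrary: ys)
    case Nil
    then show ?case by (cases ys) (simp_all add: h ua[symmetric])
  next
    case (Cons x xs)
    then show ?case by (cases ys) (auto simp: h ua uu dest: injD[OF p])
  qed
  then show ?thesis by (auto simp: inj_on_def)
qed

text \<open>The schemes of chains are no more numerous than the elements of \<open>'f + nat\<close>, and Cantor's theorem
  applies.\<close>

lemma no_inj_into_schemes:
  fixes F :: "('f + nat) set \<Rightarrow> (nat \<times> ('f \<times> nat) list) list"
  shows "\<not> inj F"
proof
  assume F: "inj F"
  have inf: "infinite (UNIV :: ('f + nat) set)" by simp
  have Inr: "inj (Inr :: nat \<Rightarrow> 'f + nat)" and Inl: "inj (Inl :: 'f \<Rightarrow> 'f + nat)" by simp_all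
  obtain g1 :: "'f \<times> nat \<Rightarrow> 'f + nat" where g1: "inj g1" using ex_inj_pair[OF Inl Inr inf] by blast
  obtain g2 :: "('f \<times> nat) list \<Rightarrow> 'f + nat" where g2: "inj g2" using ex_inj_list[OF g1 inf] by blast
  obtain g3 :: "nat \<times> ('f \<times> nat) list \<Rightarrow> 'f + nat" where g3: "inj g3"
    using ex_inj_pair[OF Inr g2 inf] by blast
  obtain g4 :: "(nat \<times> ('f \<times> nat) list) list \<Rightarrow> 'f + nat" where g4: "inj g4"
    using ex_inj_list[OF g3 inf] by blast
  have "surj (inv (g4 \<circ> F))" using inj_compose[OF g4 F] by (rule inj_imp_surj_inv)
  then show False using Cantors_theorem[of "UNIV :: ('f + nat) set"] by auto
qed


section \<open>The obstruction\<close>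

lemma rtrancl_first_step: "(x, y) \<in> r\<^sup>* \<Longrightarrow> x \<noteq> y \<Longrightarrow> \<exists>v. v \<noteq> x \<and> (x, v) \<in> r"
proof (induction rule: converse_rtrancl_induct)
  case (step x z)
  then show ?case by (cases "z = x") auto
qed simp

text \<open>A lifting of the diagram, expressed through the congruences \<open>\<theta> P s\<close> of \<open>E P\<close> that correspond to the
  elements \<open>s\<close> of \<open>flats P\<close>.\<close>

locale flat_lifting =
  fixes \<Sigma> :: "'f similarity_type" and E :: "'i set \<Rightarrow> ('f, 'a) ualgebra"
    and e :: "'i set \<Rightarrow> 'i set \<Rightarrow> 'a \<Rightarrow> 'a" and \<theta> :: "'i set \<Rightarrow> 'i flat \<Rightarrow> ('a \<times> 'a) set"
  assumes alg: "finite P \<Longrightarrow> is_ualgebra \<Sigma> (E P)"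
    and hom: "finite Q \<Longrightarrow> P \<subseteq> Q \<Longrightarrow> e P Q \<in> ualg_hom \<Sigma> (E P) (E Q)"
    and comp: "finite R \<Longrightarrow> P \<subseteq> Q \<Longrightarrow> Q \<subseteq> R \<Longrightarrow> x \<in> carrier (E P) \<Longrightarrow> e Q R (e P Q x) = e P R x"
    and compact: "finite P \<Longrightarrow> s \<in> flats P \<Longrightarrow> \<theta> P s \<in> carrier (Con_c \<Sigma> (E P))"
    and onto: "finite P \<Longrightarrow> \<alpha> \<in> carrier (Con_c \<Sigma> (E P)) \<Longrightarrow> \<exists>s \<in> flats P. \<alpha> = \<theta> P s"
    and mono: "finite P \<Longrightarrow> s \<in> flats P \<Longrightarrow> t \<in> flats P \<Longrightarrow> \<theta> P s \<subseteq> \<theta> P t \<longleftrightarrow> flat_le s t"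
    and natural: "finite Q \<Longrightarrow> P \<subseteq> Q \<Longrightarrow> s \<in> flats P \<Longrightarrow>
      Con_c_map \<Sigma> (E Q) (e P Q) (\<theta> P s) = \<theta> Q s"
begin

lemma congr:
  assumes "finite P" "s \<in> flats P" shows "congruence \<Sigma> (E P) (\<theta> P s)"
  using compact[OF assms] by (rule carrier_Con_cE) (simp add: cgen_congruence alg assms)

lemma e_closed:
  assumes "finite Q" "P \<subseteq> Q" "x \<in> carrier (E P)" shows "e P Q x \<in> carrier (E Q)"
  using hom[OF assms(1,2)] assms(3) by (auto simp: ualg_hom_def)

text \<open>The identity is the least congruence and it is compact, so it must correspond to \<open>Bot\<close>.\<close>

lemma Bot_Id:
  assumes P: "finite P" shows "\<theta> P Bot \<subseteq> Id"
proof -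
  have "cgen \<Sigma> (E P) {} \<in> carrier (Con_c \<Sigma> (E P))" by (simp add: cgen_in_Con_c)
  then obtain s where "s \<in> flats P" "cgen \<Sigma> (E P) {} = \<theta> P s"
    using onto[OF P] by blast
  then have "\<theta> P Bot \<subseteq> cgen \<Sigma> (E P) {}" using mono[OF P, of Bot s] by simp
  also have "\<dots> \<subseteq> Id_on (carrier (E P))"
    by (intro cgen_least congruence_Id_on alg P) simp
  finally show ?thesis by auto
qed

lemma principal:
  assumes "finite P" "x \<in> carrier (E P)" "y \<in> carrier (E P)"
  obtains r where "r \<in> flats P" "cgen \<Sigma> (E P) {(x, y)} = \<theta> P r"
proof -
  have "cgen \<Sigma> (E P) {(x, y)} \<in> carrier (Con_c \<Sigma> (E P))"
    using assms by (simp add: cgen_in_Con_c)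
  then show ?thesis using onto[OF assms(1)] that by blast
qed

text \<open>Compact congruences need not have a compact intersection, but every pair in the
  intersection generates a compact congruence below both.\<close>

lemma disjoint:
  assumes P: "finite P" and s: "s \<in> flats P" and t: "t \<in> flats P"
    and disj: "\<And>r. flat_le r s \<Longrightarrow> flat_le r t \<Longrightarrow> r = Bot"
  shows "\<theta> P s \<inter> \<theta> P t \<subseteq> Id"
proof (rule subrelI)
  fix a b assume ab: "(a, b) \<in> \<theta> P s \<inter> \<theta> P t"
  then have "a \<in> carrier (E P)" "b \<in> carrier (E P)"
    using congruence_carrier[OF congr[OF P s]] by auto
  then obtain r where r: "r \<in> flats P" "cgen \<Sigma> (E P) {(a, b)} = \<theta> P r" by (rule principal[OF P])
  have "\<theta> P r \<subseteq> \<theta> P s" "\<theta> P r \<subseteq> \<theta> P t"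
    unfolding r(2)[symmetric] using ab by (simp_all add: cgen_least congr P s t)
  then have "r = Bot" using disj mono[OF P r(1) s] mono[OF P r(1) t] by simp
  moreover have "(a, b) \<in> \<theta> P r" using cgen_superset[of "{(a, b)}"] r(2) by blast
  ultimately show "(a, b) \<in> Id" using Bot_Id[OF P] by blast
qed

lemma below_join:
  assumes P: "finite P" and s: "s \<in> flats P" and t: "t \<in> flats P" and u: "u \<in> flats P"
    and le: "flat_le u (flat_join s t)"
  shows "\<theta> P u \<subseteq> (\<theta> P s \<union> \<theta> P t)\<^sup>*"
proof -
  have "cgen \<Sigma> (E P) (\<theta> P s \<union> \<theta> P t) \<in> carrier (Con_c \<Sigma> (E P))"
    using Con_c_lub[OF alg[OF P] compact[OF P s] compact[OF P t]] by (simp add: least_def Upper_def)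
  then obtain r where r: "r \<in> flats P" "cgen \<Sigma> (E P) (\<theta> P s \<union> \<theta> P t) = \<theta> P r"
    using onto[OF P] by blast
  then have "\<theta> P s \<subseteq> \<theta> P r" "\<theta> P t \<subseteq> \<theta> P r"
    using cgen_superset[of "\<theta> P s \<union> \<theta> P t" \<Sigma> "E P"] by auto
  then have "flat_le s r" "flat_le t r" using mono[OF P s r(1)] mono[OF P t r(1)] by simp_all
  then have "flat_le u r" by (intro flat_le_trans[OF le] flat_join_least)
  then have "\<theta> P u \<subseteq> \<theta> P r" using mono[OF P u r(1)] by simp
  then show ?thesis
    using cgen_Un_subset_rtrancl[OF alg congr congr, OF P P s P t] r(2) by simp
qed

lemma push:
  assumes "finite Q" "P \<subseteq> Q" "s \<in> flats P" "(x, y) \<in> \<theta> P s"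
  shows "(e P Q x, e P Q y) \<in> \<theta> Q s"
proof -
  have "map_prod (e P Q) (e P Q) (x, y) \<in> map_prod (e P Q) (e P Q) ` \<theta> P s"
    using assms(4) by (rule imageI)
  then have "(e P Q x, e P Q y) \<in> Con_c_map \<Sigma> (E Q) (e P Q) (\<theta> P s)"
    unfolding Con_c_map_def by (intro subsetD[OF cgen_superset]) simp
  then show ?thesis using natural[OF assms(1-3)] by simp
qed

text \<open>The principal congruence of a pair corresponds to the same element \<open>r\<close> before and after the map;
  if the pair is collapsed, then \<open>r = Bot\<close>.\<close>

lemma e_inj:
  assumes Q: "finite Q" and PQ: "P \<subseteq> Q" and x: "x \<in> carrier (E P)" and y: "y \<in> carrier (E P)"
    and eq: "e P Q x = e P Q y"
  shows "x = y"
proof -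
  have P: "finite P" using PQ Q by (rule finite_subset)
  obtain r where r: "r \<in> flats P" "cgen \<Sigma> (E P) {(x, y)} = \<theta> P r" using x y by (rule principal[OF P])
  then have rQ: "r \<in> flats Q" using flats_mono[OF PQ] by blast
  have "\<theta> Q r = Con_c_map \<Sigma> (E Q) (e P Q) (cgen \<Sigma> (E P) {(x, y)})"
    unfolding r(2) using natural[OF Q PQ r(1)] by (rule sym)
  also have "\<dots> = cgen \<Sigma> (E Q) (map_prod (e P Q) (e P Q) ` {(x, y)})"
    by (rule Con_c_map_cgen[OF alg[OF P] alg[OF Q] hom[OF Q PQ]]) (simp add: x y)
  also have "map_prod (e P Q) (e P Q) ` {(x, y)} = {(e P Q y, e P Q y)}" by (simp add: eq)
  also have "cgen \<Sigma> (E Q) \<dots> \<subseteq> \<theta> Q Bot"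
    using congruence_refl[OF congr[OF Q], of Bot] e_closed[OF Q PQ y] by (intro cgen_least congr Q) simp_all
  finally have "r = Bot" using mono[OF Q rQ, of Bot] by simp
  then have "{(x, y)} \<subseteq> \<theta> P Bot" using cgen_superset[of "{(x, y)}" \<Sigma> "E P"] r(2) by simp
  then show ?thesis using Bot_Id[OF P] by blast
qed

text \<open>The map sends each index \<open>i\<close> to the scheme of some chain from \<open>x\<close> to an element \<open>v \<noteq> x\<close> that a near
  atom of \<open>i\<close> identifies with \<open>x\<close>.  Injectivity is the main argument of the proof.\<close>

theorem ex_inj_schemes:
  assumes inf: "infinite (UNIV :: 'i set)"
  shows "\<exists>F :: 'i \<Rightarrow> (nat \<times> ('f \<times> nat) list) list. inj F"
proof -
  have "\<not> \<theta> {} (Span {}) \<subseteq> \<theta> {} Bot" by (simp add: mono)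
  then obtain x y where xy: "(x, y) \<in> \<theta> {} (Span {})" "(x, y) \<notin> \<theta> {} Bot"
    unfolding subset_iff by force
  have x: "x \<in> carrier (E {})" and y: "y \<in> carrier (E {})"
    using subsetD[OF congruence_carrier[OF congr[of "{}" "Span {}"]] xy(1)] by simp_all
  have "(x, x) \<in> \<theta> {} Bot" by (rule congruence_refl[OF congr x]) simp_all
  then have ne: "x \<noteq> y" using xy(2) by blast
  have "\<theta> {} (Span {}) \<in> carrier (Con_c \<Sigma> (E {}))" by (rule compact) simp_all
  then obtain X where X: "finite X" "X \<subseteq> carrier (E {}) \<times> carrier (E {})" "\<theta> {} (Span {}) = cgen \<Sigma> (E {}) X"
    by (rule carrier_Con_cE)
  have "finite (X \<union> X\<inverse>)" using X(1) by simp
  from finite_list[OF this] obtain Xs where Xs: "set Xs = X \<union> X\<inverse>" by (rule exE)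
  \<comment> \<open>The image of the generators in \<open>E P\<close>, in the same order for all \<open>P\<close>, so that positions in the list
    have the same meaning in all algebras.\<close>
  define XP where "XP P = map (map_prod (e {} P) (e {} P)) Xs" for P
  have Xs_car: "set Xs \<subseteq> carrier (E {}) \<times> carrier (E {})" unfolding Xs using X(2) by blast
  have XP_set: "set (XP P) = map_prod (e {} P) (e {} P) ` (X \<union> X\<inverse>)" for P
    unfolding XP_def set_map Xs ..
  have XP_car: "set (XP P) \<subseteq> carrier (E P) \<times> carrier (E P)" if "finite P" for P
    unfolding XP_def set_map by (rule ualg_hom_pairs[OF hom[OF that empty_subsetI] Xs_car])
  have XP_sym: "sym (set (XP P))" for P
  proof (rule symI)
    fix u v assume "(u, v) \<in> set (XP P)"
    then obtain a b where "(a, b) \<in> X \<union> X\<inverse>" "u = e {} P a" "v = e {} P b"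
      unfolding XP_set by auto
    then have "(b, a) \<in> X \<union> X\<inverse>" "(v, u) = map_prod (e {} P) (e {} P) (b, a)" by auto
    then show "(v, u) \<in> set (XP P)" unfolding XP_set by (intro image_eqI)
  qed
  have XP_gen: "\<theta> P (Span {}) \<subseteq> cgen \<Sigma> (E P) (set (XP P))" if P: "finite P" for P
  proof -
    have "\<theta> P (Span {}) = Con_c_map \<Sigma> (E P) (e {} P) (cgen \<Sigma> (E {}) X)"
      unfolding X(3)[symmetric] using natural[OF P, of "{}" "Span {}"] by simp
    also have "\<dots> = cgen \<Sigma> (E P) (map_prod (e {} P) (e {} P) ` X)"
      by (rule Con_c_map_cgen[OF alg alg[OF P] hom[OF P] X(2)]) simp_all
    also have "\<dots> \<subseteq> cgen \<Sigma> (E P) (set (XP P))" by (rule cgen_mono) (auto simp: XP_set)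
    finally show ?thesis .
  qed
  have XP_le: "set (XP P) \<subseteq> \<theta> P (Span {})" if P: "finite P" for P
  proof
    fix p assume "p \<in> set (XP P)"
    then obtain a b where ab: "(a, b) \<in> X \<union> X\<inverse>" "p = (e {} P a, e {} P b)"
      unfolding XP_set by auto
    have "X \<subseteq> \<theta> {} (Span {})" unfolding X(3) by (rule cgen_superset)
    then have "(a, b) \<in> \<theta> {} (Span {})"
      using ab(1) congruence_sym[OF congr[of "{}" "Span {}"], of b a] by auto
    then show "p \<in> \<theta> P (Span {})" unfolding ab(2) by (intro push[OF P]) simp_all
  qed
  have XP_push: "map (map_prod (e P Q) (e P Q)) (XP P) = XP Q" if "finite Q" "P \<subseteq> Q" for P Q
  proof -
    have "e P Q (e {} P a) = e {} Q a" if "a \<in> carrier (E {})" for a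
      using \<open>finite Q\<close> empty_subsetI \<open>P \<subseteq> Q\<close> that by (rule comp)
    then have "(map_prod (e P Q) (e P Q) \<circ> map_prod (e {} P) (e {} P)) p = map_prod (e {} Q) (e {} Q) p"
      if "p \<in> set Xs" for p
      using subsetD[OF Xs_car that] by (cases p) simp
    then show ?thesis unfolding XP_def map_map by (rule map_cong[OF refl])
  qed

  define reach where "reach i ss \<longleftrightarrow> (\<exists>css v t. v \<noteq> e {} {i} x \<and> (e {} {i} x, v) \<in> \<theta> {i} (Near i t) \<and>
      malcev_chain \<Sigma> (E {i}) (XP {i}) ss css (e {} {i} x) v)" for i ss
  have ex_reach: "\<exists>ss. reach i ss" for i
  proof -
    let ?x = "e {} {i} x" and ?y = "e {} {i} y"
    have "?x \<noteq> ?y" using e_inj[of "{i}" "{}" x y] x y ne by auto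
    have "flat_join (Near i True) (Near i False) = Span {}" by (simp add: flat_join_def)
    then have "(?x, ?y) \<in> (\<theta> {i} (Near i True) \<union> \<theta> {i} (Near i False))\<^sup>*"
      using below_join[of "{i}" "Near i True" "Near i False" "Span {}"]
        push[of "{i}" "{}" "Span {}" x y] xy(1) by auto
    then obtain v t where v: "v \<noteq> ?x" "(?x, v) \<in> \<theta> {i} (Near i t)"
      using rtrancl_first_step[OF _ \<open>?x \<noteq> ?y\<close>] by blast
    have "\<theta> {i} (Near i t) \<subseteq> \<theta> {i} (Span {})" by (simp add: mono)
    also have "\<dots> \<subseteq> cgen \<Sigma> (E {i}) (set (XP {i}))" by (rule XP_gen) simp
    finally have "(?x, v) \<in> cgen \<Sigma> (E {i}) (set (XP {i}))" using v(2) by (rule subsetD)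
    from ex_malcev_chain[OF alg XP_car XP_sym this] obtain ss css
      where "malcev_chain \<Sigma> (E {i}) (XP {i}) ss css ?x v" by auto
    with v have "reach i ss" unfolding reach_def by (intro exI conjI)
    then show ?thesis by (rule exI)
  qed
  define F where "F i = (SOME ss. reach i ss)" for i
  have F: "reach i (F i)" for i unfolding F_def by (rule someI_ex[OF ex_reach])
  have "inj F"
  proof (rule injI, rule ccontr)
    fix i j assume Fij: "F i = F j" and ij: "i \<noteq> j"
    obtain ci vi ti where i: "vi \<noteq> e {} {i} x" "(e {} {i} x, vi) \<in> \<theta> {i} (Near i ti)"
        "malcev_chain \<Sigma> (E {i}) (XP {i}) (F i) ci (e {} {i} x) vi"
      using F[of i] unfolding reach_def by blast
    obtain cj vj tj where j: "vj \<noteq> e {} {j} x" "(e {} {j} x, vj) \<in> \<theta> {j} (Near j tj)"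
        "malcev_chain \<Sigma> (E {j}) (XP {j}) (F i) cj (e {} {j} x) vj"
      using F[of j] unfolding reach_def Fij by blast
    obtain n where n: "n \<notin> {i, j}" using ex_new_if_finite[OF inf, of "{i, j}"] by auto
    \<comment> \<open>The parameters are compared in \<open>E Q\<close>, where the congruence that they generate cannot involve
      \<open>n\<close>; the chains are compared in \<open>E R\<close>.\<close>
    define Q where "Q = {i, j}"
    define R where "R = {n, i, j}"
    have fin: "finite Q" "finite R" and sub: "{i} \<subseteq> Q" "{j} \<subseteq> Q" "Q \<subseteq> R" "{i} \<subseteq> R" "{j} \<subseteq> R"
      by (auto simp: Q_def R_def)
    define ci' where "ci' = map (map (map (e {i} Q))) ci"
    define cj' where "cj' = map (map (map (e {j} Q))) cj"
    have chain_i: "malcev_chain \<Sigma> (E Q) (XP Q) (F i) ci' (e {} Q x) (e {i} Q vi)"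
      using malcev_chain_hom[OF alg hom[OF fin(1) sub(1)] XP_car i(3)] XP_push[OF fin(1) sub(1)]
        comp[OF fin(1) _ sub(1) x] by (simp add: ci'_def)
    have chain_j: "malcev_chain \<Sigma> (E Q) (XP Q) (F i) cj' (e {} Q x) (e {j} Q vj)"
      using malcev_chain_hom[OF alg hom[OF fin(1) sub(2)] XP_car j(3)] XP_push[OF fin(1) sub(2)]
        comp[OF fin(1) _ sub(2) x] by (simp add: cj'_def)
    define C where "C = set (concat (concat ci')) \<union> set (concat (concat cj'))"
    have "finite (C \<times> C)" by (simp add: C_def)
    moreover have "C \<subseteq> carrier (E Q)"
      unfolding C_def by (rule Un_least[OF malcev_chain_params[OF chain_i] malcev_chain_params[OF chain_j]])
    ultimately have "cgen \<Sigma> (E Q) (C \<times> C) \<in> carrier (Con_c \<Sigma> (E Q))"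
      by (intro cgen_in_Con_c Sigma_mono)
    then obtain s where s: "s \<in> flats Q" "cgen \<Sigma> (E Q) (C \<times> C) = \<theta> Q s"
      using onto[OF fin(1)] by blast
    have sR: "s \<in> flats R" using s(1) by (rule subsetD[OF flats_mono[OF sub(3)]])
    let ?g = "e Q R"
    have "list_all2 (list_all2 (list_all2 (\<lambda>c c'. (?g c, ?g c') \<in> \<theta> R s))) ci' cj'"
    proof (rule malcev_chain_parallel[OF chain_i chain_j])
      fix c c' assume "c \<in> set (concat (concat ci'))" "c' \<in> set (concat (concat cj'))"
      then have "(c, c') \<in> C \<times> C" by (simp only: C_def mem_Sigma_iff Un_iff simp_thms)
      then have "(c, c') \<in> \<theta> Q s" unfolding s(2)[symmetric] by (rule subsetD[OF cgen_superset])
      then show "(?g c, ?g c') \<in> \<theta> R s" by (rule push[OF fin(2) sub(3) s(1)])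
    qed
    then have par: "list_all2 (list_all2 (list_all2 (\<lambda>c c'. (c, c') \<in> \<theta> R s)))
        (map (map (map ?g)) ci') (map (map (map ?g)) cj')"
      by (simp only: list_all2_map_both)
    have far: "Far n t \<in> flats R" for t by (simp add: R_def)
    have ns: "n \<notin> support s" using support_flats[OF s(1)] n by (auto simp: Q_def)
    have disj: "\<theta> R s \<inter> \<theta> R (Far n t) \<subseteq> Id" for t
      by (intro disjoint fin sR far) (rule far_disjoint[OF ns])
    have XR: "set (XP R) \<subseteq> (\<theta> R (Far n True) \<union> \<theta> R (Far n False))\<^sup>*"
      by (rule subset_trans[OF XP_le[OF fin(2)] below_join[OF fin(2) far far]])
         (simp_all add: flat_join_def)
    have "?g (e {i} Q vi) = ?g (e {j} Q vj)"
    proof (rule malcev_chain_unique[OF congr[OF fin(2) sR] congr[OF fin(2) far] congr[OF fin(2) far]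
          disj disj XR _ _ par])
      show "malcev_chain \<Sigma> (E R) (XP R) (F i) (map (map (map ?g)) ci') (?g (e {} Q x)) (?g (e {i} Q vi))"
        using malcev_chain_hom[OF alg hom[OF fin(2) sub(3)] XP_car chain_i] XP_push[OF fin(2) sub(3)] fin
        by simp
      show "malcev_chain \<Sigma> (E R) (XP R) (F i) (map (map (map ?g)) cj') (?g (e {} Q x)) (?g (e {j} Q vj))"
        using malcev_chain_hom[OF alg hom[OF fin(2) sub(3)] XP_car chain_j] XP_push[OF fin(2) sub(3)] fin
        by simp
    qed
    moreover have vi: "vi \<in> carrier (E {i})" and vj: "vj \<in> carrier (E {j})"
      using i(2) j(2) congruence_carrier[OF congr[of "{i}" "Near i ti"]]
        congruence_carrier[OF congr[of "{j}" "Near j tj"]] by auto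
    ultimately have eq: "e {i} R vi = e {j} R vj"
      using comp[OF fin(2) sub(1,3) vi] comp[OF fin(2) sub(2,3) vj] by simp
    have "(e {} R x, e {i} R vi) \<in> \<theta> R (Near i ti)"
      using push[OF fin(2) sub(4) _ i(2)] comp[OF fin(2) _ sub(4) x] by simp
    moreover have "(e {} R x, e {i} R vi) \<in> \<theta> R (Near j tj)"
      using push[OF fin(2) sub(5) _ j(2)] comp[OF fin(2) _ sub(5) x] by (simp add: eq)
    moreover have "\<theta> R (Near i ti) \<inter> \<theta> R (Near j tj) \<subseteq> Id"
      by (rule disjoint[OF fin(2) _ _ near_disjoint[OF ij]]) (simp_all add: R_def)
    ultimately have "e {} R x = e {i} R vi" by blast
    then have "e {i} R vi = e {i} R (e {} {i} x)"
      using comp[OF fin(2) empty_subsetI sub(4) x] by simp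
    then have "vi = e {} {i} x"
      by (intro e_inj[OF fin(2) sub(4) vi] e_closed x) simp_all
    then show False using i(1) by simp
  qed
  then show ?thesis by blast
qed

end

section \<open>The diagram has no lifting\<close>

text \<open>The natural isomorphism preserves joins, hence it preserves and reflects the order.\<close>

lemma flat_lifting_if_lifting:
  fixes E :: "'i set \<Rightarrow> ('f, 'a) ualgebra"
  assumes "is_lifting \<Sigma> finite_subsets flat_object flat_arrow E e"
  obtains \<theta> where "flat_lifting \<Sigma> E e \<theta>"
proof -
  let ?I = "finite_subsets :: 'i set gorder"
  have I: "carrier ?I = {P. finite P}" "P \<sqsubseteq>\<^bsub>?I\<^esub> Q \<longleftrightarrow> P \<subseteq> Q" for P Q
    by (simp_all add: finite_subsets_def)
  have diag: "ualg_diagram \<Sigma> ?I E e"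
    and nat: "\<exists>\<eta>. (\<forall>P \<in> carrier ?I. \<eta> P \<in> slat_iso (Con_c \<Sigma> (E P)) (flat_object P)) \<and>
      (\<forall>P \<in> carrier ?I. \<forall>Q \<in> carrier ?I. P \<sqsubseteq>\<^bsub>?I\<^esub> Q \<longrightarrow>
        (\<forall>\<alpha> \<in> carrier (Con_c \<Sigma> (E P)). \<eta> Q (Con_c_map \<Sigma> (E Q) (e P Q) \<alpha>) = flat_arrow P Q (\<eta> P \<alpha>)))"
    using assms unfolding is_lifting_def by blast+
  have alg: "is_ualgebra \<Sigma> (E P)" if "finite P" for P
    using diag that by (simp add: poset_functor_def I)
  have hom: "e P Q \<in> ualg_hom \<Sigma> (E P) (E Q)" if "finite Q" "P \<subseteq> Q" for P Q
    using diag that finite_subset[OF that(2,1)] by (simp add: poset_functor_def I)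
  have comp: "e Q R (e P Q x) = e P R x"
    if "finite R" "P \<subseteq> Q" "Q \<subseteq> R" "x \<in> carrier (E P)" for P Q R x
  proof -
    have "finite Q" using that(3,1) by (rule finite_subset)
    moreover have "finite P" using that(2) \<open>finite Q\<close> by (rule finite_subset)
    ultimately show ?thesis using diag that by (simp add: poset_functor_def I)
  qed
  from nat obtain \<eta> where \<eta>: "\<forall>P. finite P \<longrightarrow> \<eta> P \<in> slat_iso (Con_c \<Sigma> (E P)) (flat_object P)"
    "\<forall>P. finite P \<longrightarrow> (\<forall>Q. finite Q \<longrightarrow> P \<subseteq> Q \<longrightarrow> (\<forall>\<alpha> \<in> carrier (Con_c \<Sigma> (E P)).
      \<eta> Q (Con_c_map \<Sigma> (E Q) (e P Q) \<alpha>) = flat_arrow P Q (\<eta> P \<alpha>)))"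
    by (simp add: I) (elim exE conjE)
  then have iso: "\<eta> P \<in> slat_iso (Con_c \<Sigma> (E P)) (flat_object P)" if "finite P" for P
    using that by blast
  have nat': "\<eta> Q (Con_c_map \<Sigma> (E Q) (e P Q) \<alpha>) = flat_arrow P Q (\<eta> P \<alpha>)"
    if "finite P" "finite Q" "P \<subseteq> Q" "\<alpha> \<in> carrier (Con_c \<Sigma> (E P))" for P Q \<alpha>
    using \<eta>(2) that by blast
  have eta_bij: "bij_betw (\<eta> P) (carrier (Con_c \<Sigma> (E P))) (carrier (flat_object P))" if "finite P" for P
    using iso[OF that] by (simp add: slat_iso_def)
  have copy: "flats_copy P (flat_object P) (flat_point P)" if "finite P" for P :: "'i set"
    using that by (rule flats_copy_object)
  define \<theta> where "\<theta> P s = inv_into (carrier (Con_c \<Sigma> (E P))) (\<eta> P) (flat_point P s)" for P s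
  have \<theta>: "\<theta> P s \<in> carrier (Con_c \<Sigma> (E P))" "\<eta> P (\<theta> P s) = flat_point P s"
    if P: "finite P" and s: "s \<in> flats P" for P s
    using eta_bij[OF P] flats_copy.h_closed[OF copy[OF P] s]
    by (simp_all add: \<theta>_def bij_betw_def inv_into_into f_inv_into_f)
  have \<theta>I: "\<alpha> = \<theta> P s"
    if "finite P" "s \<in> flats P" "\<alpha> \<in> carrier (Con_c \<Sigma> (E P))" "\<eta> P \<alpha> = flat_point P s" for P s \<alpha>
    using eta_bij[OF that(1)] that(3,4) \<theta>[OF that(1,2)] by (auto simp: bij_betw_def inj_on_def)
  have "flat_lifting \<Sigma> E e \<theta>"
  proof
    fix P \<alpha> assume P: "finite P" and \<alpha>: "\<alpha> \<in> carrier (Con_c \<Sigma> (E P))"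
    interpret flats_copy P "flat_object P" "flat_point P" using P by (rule copy)
    have "\<eta> P \<alpha> \<in> carrier (flat_object P)" using eta_bij[OF P] \<alpha> by (auto simp: bij_betw_def)
    then show "\<exists>s \<in> flats P. \<alpha> = \<theta> P s" using \<theta>I[OF P _ \<alpha>] by (auto elim: carrier_flat)
  next
    fix P :: "'i set" and s t assume P: "finite P" and s: "s \<in> flats P" and t: "t \<in> flats P"
    interpret flats_copy P "flat_object P" "flat_point P" using P by (rule copy)
    note s' = \<theta>[OF P s] and t' = \<theta>[OF P t]
    let ?j = "\<theta> P s \<squnion>\<^bsub>Con_c \<Sigma> (E P)\<^esub> \<theta> P t"
    have j: "?j = cgen \<Sigma> (E P) (\<theta> P s \<union> \<theta> P t)" by (rule join_Con_c[OF alg[OF P] s'(1) t'(1)])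
    have jc: "?j \<in> carrier (Con_c \<Sigma> (E P))"
      using Con_c_lub[OF alg[OF P] s'(1) t'(1)] unfolding j by (simp add: least_def Upper_def)
    have "congruence \<Sigma> (E P) (\<theta> P t)"
      using t'(1) by (rule carrier_Con_cE) (simp add: cgen_congruence alg P)
    then have "\<theta> P s \<subseteq> \<theta> P t \<longleftrightarrow> ?j = \<theta> P t"
      unfolding j using cgen_superset[of "\<theta> P s \<union> \<theta> P t" \<Sigma> "E P"] cgen_least[of \<Sigma> "E P" "\<theta> P t" "\<theta> P s \<union> \<theta> P t"]
      by auto
    also have "\<dots> \<longleftrightarrow> \<eta> P ?j = \<eta> P (\<theta> P t)"
      using eta_bij[OF P] jc t'(1) by (auto simp: bij_betw_def inj_on_def)
    also have "\<eta> P ?j = flat_point P (flat_join s t)"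
      using iso[OF P] s' t' s t by (simp add: slat_iso_def slat_hom_def join_eq)
    also have "\<dots> = \<eta> P (\<theta> P t) \<longleftrightarrow> flat_join s t = t"
      using t'(2) h_inj[OF flat_join_closed[OF s t] t] by simp
    also have "\<dots> \<longleftrightarrow> flat_le s t"
      using flat_join_upper(1)[of s t] by (auto simp: flat_join_def)
    finally show "\<theta> P s \<subseteq> \<theta> P t \<longleftrightarrow> flat_le s t" .
  next
    fix P Q :: "'i set" and s assume Q: "finite Q" and PQ: "P \<subseteq> Q" and s: "s \<in> flats P"
    have P: "finite P" using PQ Q by (rule finite_subset)
    note s' = \<theta>[OF P s]
    have "Con_c_map \<Sigma> (E Q) (e P Q) (\<theta> P s) \<in> carrier (Con_c \<Sigma> (E Q))"
      using Con_c_map_slat_hom[OF alg[OF P] alg[OF Q] hom[OF Q PQ]] s'(1) by (auto simp: slat_hom_def)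
    then show "Con_c_map \<Sigma> (E Q) (e P Q) (\<theta> P s) = \<theta> Q s"
      using flats_mono[OF PQ] s nat'[OF P Q PQ s'(1)] s'(2) flat_arrow_point[OF P s]
      by (intro \<theta>I[OF Q]) auto
  qed (use alg hom comp \<theta> in auto)
  then show ?thesis by (rule that)
qed

theorem proposition7p6:
  fixes \<Sigma> :: "'f similarity_type"
  shows "\<exists>(I :: ('f + nat) set set gorder)
           (D :: ('f + nat) set set \<Rightarrow> (nat \<Rightarrow> nat) gorder)
           (d :: ('f + nat) set set \<Rightarrow> ('f + nat) set set \<Rightarrow> (nat \<Rightarrow> nat) \<Rightarrow> (nat \<Rightarrow> nat)).
      distributive_lattice I \<and>
      slat_diagram I D d \<and>
      (\<forall>i \<in> carrier I. \<exists>n L. (\<forall>k<n. finite_simple_lattice (L k)) \<and> D i = product_order n L) \<and>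
      (\<forall>i \<in> carrier I. \<forall>j \<in> carrier I. i \<sqsubseteq>\<^bsub>I\<^esub> j \<longrightarrow> inj_on (d i j) (carrier (D i))) \<and>
      \<not> has_lifting \<Sigma> I D d"
proof (intro exI conjI)
  let ?I = "finite_subsets :: ('f + nat) set set gorder"
  show "distributive_lattice ?I" by (rule distributive_lattice_finite_subsets)
  show "slat_diagram ?I flat_object flat_arrow" by (rule slat_diagram_flats)
  show "\<forall>P \<in> carrier ?I. \<exists>n L. (\<forall>k<n. finite_simple_lattice (L k)) \<and> flat_object P = product_order n L"
  proof
    fix P assume "P \<in> carrier ?I"
    then have "finite_simple_lattice (flat_lattice P)"
      by (intro flats_copy_simple[OF flats_copy_lattice]) (simp_all add: finite_subsets_def)
    then have "(\<forall>k<1. finite_simple_lattice (flat_lattice P)) \<and>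
        flat_object P = product_order 1 (\<lambda>_. flat_lattice P)"
      by (simp add: flat_object_def)
    then show "\<exists>n L. (\<forall>k<n. finite_simple_lattice (L k)) \<and> flat_object P = product_order n L"
      by (intro exI)
  qed
  show "\<forall>P \<in> carrier ?I. \<forall>Q \<in> carrier ?I. P \<sqsubseteq>\<^bsub>?I\<^esub> Q \<longrightarrow> inj_on (flat_arrow P Q) (carrier (flat_object P))"
  proof (intro ballI impI)
    fix P Q assume "P \<in> carrier ?I" "Q \<in> carrier ?I" "P \<sqsubseteq>\<^bsub>?I\<^esub> Q"
    then have P: "finite P" and Q: "finite Q" and PQ: "P \<subseteq> Q" by (simp_all add: finite_subsets_def)
    show "inj_on (flat_arrow P Q) (carrier (flat_object P))"
      by (rule flats_inclusion_slat_hom(2)[OF flats_copy_object[OF P] flats_copy_object[OF Q] PQ])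
         (rule flat_arrow_point[OF P])
  qed
  show "\<not> has_lifting \<Sigma> ?I flat_object flat_arrow"
  proof
    assume "has_lifting \<Sigma> ?I flat_object flat_arrow"
    then obtain E :: "('f + nat) set set \<Rightarrow> ('f, (('f + nat) set set, nat \<Rightarrow> nat, 'f) elem_name) ualgebra"
      and e where "is_lifting \<Sigma> ?I flat_object flat_arrow E e"
      unfolding has_lifting_def by blast
    then obtain \<theta> where "flat_lifting \<Sigma> E e \<theta>" by (rule flat_lifting_if_lifting)
    moreover have "infinite (UNIV :: ('f + nat) set set)"
      by (simp only: Pow_UNIV[symmetric] finite_Pow_iff) simp
    ultimately have "\<exists>F :: ('f + nat) set \<Rightarrow> (nat \<times> ('f \<times> nat) list) list. inj F"
      by (rule flat_lifting.ex_inj_schemes)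
    then show False using no_inj_into_schemes by blast
  qed
qed

end
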